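(* Let $K$ be a field, $S=K[x_1,\dots,x_n]$, and let $I\subset S$ be a polymatroidal ideal. Then $I$ satisfies the $1$st homological strong persistence property, that is, $$\mathrm{HS}_1(I^{k+1}):I=\mathrm{HS}_1(I^k)\quad\text{for all }k\ge1.$$ In particular, $\mathrm{Ass}\,\mathrm{HS}_1(I)\subset\mathrm{Ass}\,\mathrm{HS}_1(I^2)\subset\mathrm{Ass}\,\mathrm{HS}_1(I^3)\subset\cdots$.
   Context: $S$ carries its standard $\mathbb{Z}^n$-grading. For a monomial ideal $J$, $\mathcal{G}(J)$ denotes its minimal set of monomial generators, and $\deg_{x_i}(u)$ is the exponent of $x_i$ in the monomial $u$. For $i\ge0$, $\mathrm{HS}_i(J)=(\mathbf{x}^{\mathbf a}:\ \mathrm{Tor}_i^S(K,J)_{\mathbf a}\neq0)$, where $\mathbf{x}^{\mathbf a}=x_1^{a_1}\cdots x_n^{a_n}$ (the zero ideal if $\mathrm{Tor}_i^S(K,J)=0$). For an ideal $L\subset S$, $\mathrm{Ass}\,L$ denotes the set of associated primes of $S/L$. Inclusions $\subset$ are not necessarily strict. A nonzero monomial ideal $I$ is polymatroidal if all elements of $\mathcal{G}(I)$ have the same degree and: for all $u,v\in\mathcal{G}(I)$ and all $i$ with $\deg_{x_i}(u)>\deg_{x_i}(v)$, there is $j$ with $\deg_{x_j}(u)<\deg_{x_j}(v)$ such that $x_j(u/x_i)\in\mathcal{G}(I)$. *)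

theory Defs
  imports Complex_Main "HOL-Library.Poly_Mapping"
begin

text \<open>
  The polynomial ring over \<open>'k\<close> whose variables are the elements of the finite type \<open>'n\<close>;
  exponent vectors of monomials are finitely supported maps \<open>'n \<Rightarrow>\<^sub>0 nat\<close>.
\<close>

type_synonym 'n expo = "'n \<Rightarrow>\<^sub>0 nat"
type_synonym ('n, 'k) mpoly = "('n \<Rightarrow>\<^sub>0 nat) \<Rightarrow>\<^sub>0 'k"

abbreviation monom :: "'n expo \<Rightarrow> ('n, 'k::zero_neq_one) mpoly"
  where "monom a \<equiv> Poly_Mapping.single a 1"

abbreviation unit_expo :: "'n \<Rightarrow> 'n expo"
  where "unit_expo i \<equiv> Poly_Mapping.single i 1"


section \<open>Ideals\<close>

interpretation ideal: module "(*) :: 'a::comm_ring_1 \<Rightarrow> 'a \<Rightarrow> 'a"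
  by unfold_locales (simp_all add: algebra_simps)

abbreviation is_ideal :: "'a::comm_ring_1 set \<Rightarrow> bool"
  where "is_ideal \<equiv> module.subspace (*)"

abbreviation ideal_of :: "'a::comm_ring_1 set \<Rightarrow> 'a set"
  where "ideal_of \<equiv> module.span (*)"

definition ideal_mult :: "'a::comm_ring_1 set \<Rightarrow> 'a set \<Rightarrow> 'a set"
  where "ideal_mult A B = ideal_of {a * b | a b. a \<in> A \<and> b \<in> B}"

fun ideal_power :: "'a::comm_ring_1 set \<Rightarrow> nat \<Rightarrow> 'a set" where
  "ideal_power A 0 = UNIV"
| "ideal_power A (Suc k) = ideal_mult A (ideal_power A k)"

definition ideal_colon :: "'a::comm_ring_1 set \<Rightarrow> 'a set \<Rightarrow> 'a set"
  where "ideal_colon A B = {f. \<forall>g\<in>B. f * g \<in> A}"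

definition prime_ideal :: "'a::comm_ring_1 set \<Rightarrow> bool"
  where "prime_ideal p \<longleftrightarrow>
    is_ideal p \<and> p \<noteq> UNIV \<and> (\<forall>f g. f * g \<in> p \<longrightarrow> f \<in> p \<or> g \<in> p)"

text \<open>
  Associated primes of the quotient by \<open>L\<close>: the prime ideals that are annihilators
  of a residue class \<open>f + L\<close>.
\<close>

definition Ass :: "'a::comm_ring_1 set \<Rightarrow> 'a set set"
  where "Ass L = {p. prime_ideal p \<and> (\<exists>f. p = {g. g * f \<in> L})}"


section \<open>Monomial and polymatroidal ideals\<close>

definition monomial_ideal :: "('n, 'k::comm_ring_1) mpoly set \<Rightarrow> bool"
  where "monomial_ideal J \<longleftrightarrow> (\<exists>A. J = ideal_of (monom ` A))"

text \<open>
  Exponent vectors of the minimal monomial generators: the monomials of \<open>J\<close> that are minimal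
  with respect to divisibility. See \<open>min_gens_unique\<close> below.
\<close>

definition min_gens :: "('n, 'k::comm_ring_1) mpoly set \<Rightarrow> 'n expo set"
  where "min_gens J = {a. monom a \<in> J \<and> (\<forall>b c. a = b + c \<and> monom b \<in> J \<longrightarrow> b = a)}"

definition polymatroidal :: "('n::finite, 'k::field) mpoly set \<Rightarrow> bool"
  where "polymatroidal I \<longleftrightarrow>
    monomial_ideal I \<and> I \<noteq> {0} \<and>
    (\<forall>u\<in>min_gens I. \<forall>v\<in>min_gens I.
       (\<Sum>i\<in>UNIV. Poly_Mapping.lookup u i) = (\<Sum>i\<in>UNIV. Poly_Mapping.lookup v i)) \<and>
    (\<forall>u\<in>min_gens I. \<forall>v\<in>min_gens I. \<forall>i. Poly_Mapping.lookup u i > Poly_Mapping.lookup v i \<longrightarrow>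
       (\<exists>j. Poly_Mapping.lookup u j < Poly_Mapping.lookup v j \<and> (u - unit_expo i) + unit_expo j \<in> min_gens I))"

lemma monom_in_ideal_of_iff:
  "(monom a :: ('n, 'k::comm_ring_1) mpoly) \<in> ideal_of (monom ` A) \<longleftrightarrow> (\<exists>b\<in>A. \<exists>c. a = b + c)"
proof
  assume a: "(monom a :: ('n, 'k) mpoly) \<in> ideal_of (monom ` A)"
  have "\<forall>m\<in>Poly_Mapping.keys f. \<exists>b\<in>A. \<exists>c. m = b + c"
    if "f \<in> ideal_of (monom ` A)" for f :: "('n, 'k) mpoly"
    using that
  proof (induction rule: ideal.span_induct_alt)
    case base
    show ?case by simp
  next
    case (step r x f)
    then obtain b where b: "b \<in> A" "x = monom b" by auto
    show ?case
    proof
      fix m assume "m \<in> Poly_Mapping.keys (r * x + f)"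
      then consider "m \<in> Poly_Mapping.keys (r * x)" | "m \<in> Poly_Mapping.keys f"
        using keys_add[of "r * x" f] by auto
      then show "\<exists>b\<in>A. \<exists>c. m = b + c"
      proof cases
        case 1
        then obtain c d where "m = c + d" "d \<in> Poly_Mapping.keys x"
          using keys_mult by blast
        then show ?thesis using b by (auto simp: add.commute)
      next
        case 2
        then show ?thesis using step.IH by blast
      qed
    qed
  qed
  from this[OF a] show "\<exists>b\<in>A. \<exists>c. a = b + c" by simp
next
  assume "\<exists>b\<in>A. \<exists>c. a = b + c"
  then obtain b c where bc: "b \<in> A" "a = b + c" by blast
  have "(monom c * monom b :: ('n, 'k) mpoly) \<in> ideal_of (monom ` A)"
    using bc by (intro ideal.span_scale ideal.span_base) auto
  then show "(monom a :: ('n, 'k) mpoly) \<in> ideal_of (monom ` A)"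
    by (simp add: mult_single bc add.commute)
qed

lemma expo_divides_minimal:
  fixes J :: "('n::finite, 'k::comm_ring_1) mpoly set"
  assumes "monom a \<in> J"
  shows "\<exists>b\<in>min_gens J. \<exists>c. a = b + c"
  using assms
proof (induction "\<Sum>i\<in>UNIV. Poly_Mapping.lookup a i" arbitrary: a rule: less_induct)
  case less
  show ?case
  proof (cases "a \<in> min_gens J")
    case True
    then show ?thesis by (metis add.right_neutral)
  next
    case False
    with less.prems obtain b c where bc: "a = b + c" "monom b \<in> J" "b \<noteq> a"
      by (auto simp: min_gens_def)
    from bc have "c \<noteq> 0" by auto
    then obtain j where "Poly_Mapping.lookup c j > 0"
      by (metis gr0I lookup_zero poly_mapping_eqI)
    then have "(\<Sum>i\<in>UNIV. Poly_Mapping.lookup c i) > 0"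
      by (metis finite UNIV_I sum_pos2 zero_le)
    then have "(\<Sum>i\<in>UNIV. Poly_Mapping.lookup b i) < (\<Sum>i\<in>UNIV. Poly_Mapping.lookup a i)"
      by (simp add: bc lookup_add sum.distrib)
    from less.hyps[OF this bc(2)] obtain d e where "d \<in> min_gens J" "b = d + e" by blast
    then show ?thesis using bc(1) by (metis add.assoc)
  qed
qed

lemma min_gens_unique:
  fixes J :: "('n::finite, 'k::comm_ring_1) mpoly set"
  assumes "monomial_ideal J"
  shows "ideal_of (monom ` A) = J \<and> (\<forall>B\<subset>A. ideal_of (monom ` B) \<noteq> J) \<longleftrightarrow> A = min_gens J"
proof -
  obtain C where C: "J = ideal_of (monom ` C)"
    using assms by (auto simp: monomial_ideal_def)
  have sub: "min_gens J \<subseteq> A" if "ideal_of (monom ` A) = J" for A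
  proof
    fix a assume a: "a \<in> min_gens J"
    then have "monom a \<in> ideal_of (monom ` A :: ('n, 'k) mpoly set)"
      using that by (simp add: min_gens_def)
    then obtain b c where bc: "b \<in> A" "a = b + c"
      by (auto simp: monom_in_ideal_of_iff)
    have "monom b \<in> J"
      unfolding that[symmetric] by (rule ideal.span_base) (rule imageI[OF bc(1)])
    with a bc(2) have "b = a" unfolding min_gens_def by blast
    with bc(1) show "a \<in> A" by simp
  qed
  have "monom ` C \<subseteq> ideal_of (monom ` min_gens J :: ('n, 'k) mpoly set)"
  proof
    fix f :: "('n, 'k) mpoly"
    assume "f \<in> monom ` C"
    then obtain a where a: "a \<in> C" "f = monom a" by blast
    then have "monom a \<in> J" unfolding C by (intro ideal.span_base) blast
    then have "\<exists>b\<in>min_gens J. \<exists>c. a = b + c" by (rule expo_divides_minimal)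
    then show "f \<in> ideal_of (monom ` min_gens J)"
      unfolding a(2) monom_in_ideal_of_iff .
  qed
  from ideal.span_minimal[OF this ideal.subspace_span]
  have "J \<subseteq> ideal_of (monom ` min_gens J)"
    unfolding C[symmetric] .
  moreover have "ideal_of (monom ` min_gens J) \<subseteq> J"
  proof (rule ideal.span_minimal)
    show "monom ` min_gens J \<subseteq> J" by (auto simp: min_gens_def)
    show "is_ideal J" unfolding C by (rule ideal.subspace_span)
  qed
  ultimately have gen: "ideal_of (monom ` min_gens J) = J" by blast
  show ?thesis
  proof
    assume "A = min_gens J"
    moreover have "ideal_of (monom ` B) \<noteq> J" if "B \<subset> min_gens J" for B
      using sub[of B] that by (meson psubsetE)
    ultimately show "ideal_of (monom ` A) = J \<and> (\<forall>B\<subset>A. ideal_of (monom ` B) \<noteq> J)"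
      using gen by simp
  next
    assume A: "ideal_of (monom ` A) = J \<and> (\<forall>B\<subset>A. ideal_of (monom ` B) \<noteq> J)"
    have "min_gens J \<subseteq> A" using A by (intro sub) (rule conjunct1)
    moreover have "\<not> min_gens J \<subset> A" using A gen by (meson conjunct2)
    ultimately show "A = min_gens J" by (simp add: psubset_eq)
  qed
qed


section \<open>Multigraded Tor and homological shift ideals\<close>

text \<open>
  A complex \<open>\<dots> \<rightarrow> P\<^sub>1 \<rightarrow> P\<^sub>0 \<rightarrow> K\<close> of finitely generated multigraded free modules over the
  polynomial ring, augmented to the residue field of the ideal generated by the variables.
  The module \<open>P\<^sub>i\<close> has basis \<open>{..<rank P i}\<close>, with basis element \<open>b\<close> in degree \<open>shift P i b\<close>;
  \<open>diff P i b c\<close> is the coefficient at \<open>c\<close> of the image of \<open>b\<close> under \<open>P\<^sub>i\<^sub>+\<^sub>1 \<rightarrow> P\<^sub>i\<close>, and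
  \<open>aug P b\<close> is the image of \<open>b\<close> under \<open>P\<^sub>0 \<rightarrow> K\<close>. It is no restriction that all shifts are
  nonnegative, because the residue field lives in degree \<open>0\<close>.
\<close>

record ('e, 's, 'k) complex_data =
  rank :: "nat \<Rightarrow> nat"
  shift :: "nat \<Rightarrow> nat \<Rightarrow> 'e"
  diff :: "nat \<Rightarrow> nat \<Rightarrow> nat \<Rightarrow> 's"
  aug :: "nat \<Rightarrow> 'k"

type_synonym ('n, 'k) free_complex = "('n expo, ('n, 'k) mpoly, 'k) complex_data"

text \<open>
  For an ideal \<open>J\<close>, the module \<open>P\<^sub>i \<otimes> J\<close> is identified with the direct sum of \<open>rank P i\<close>
  copies of \<open>J\<close>; \<open>boundary_map P i\<close> is the map \<open>P\<^sub>i\<^sub>+\<^sub>1 \<otimes> J \<rightarrow> P\<^sub>i \<otimes> J\<close>. The complex itself is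
  the case \<open>J = UNIV\<close>.
\<close>

definition chains :: "('n, 'k::comm_ring_1) free_complex \<Rightarrow> ('n, 'k) mpoly set \<Rightarrow> nat
    \<Rightarrow> (nat \<Rightarrow> ('n, 'k) mpoly) set"
  where "chains P J i = {v. (\<forall>b<rank P i. v b \<in> J) \<and> (\<forall>b\<ge>rank P i. v b = 0)}"

definition boundary_map :: "('n, 'k::comm_ring_1) free_complex \<Rightarrow> nat
    \<Rightarrow> (nat \<Rightarrow> ('n, 'k) mpoly) \<Rightarrow> nat \<Rightarrow> ('n, 'k) mpoly"
  where "boundary_map P i v =
    (\<lambda>c. if c < rank P i then \<Sum>b<rank P (Suc i). v b * diff P i b c else 0)"

fun cycles :: "('n, 'k::comm_ring_1) free_complex \<Rightarrow> ('n, 'k) mpoly set \<Rightarrow> nat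
    \<Rightarrow> (nat \<Rightarrow> ('n, 'k) mpoly) set" where
  "cycles P J 0 = chains P J 0"
| "cycles P J (Suc i) = {v \<in> chains P J (Suc i). boundary_map P i v = (\<lambda>_. 0)}"

definition boundaries :: "('n, 'k::comm_ring_1) free_complex \<Rightarrow> ('n, 'k) mpoly set \<Rightarrow> nat
    \<Rightarrow> (nat \<Rightarrow> ('n, 'k) mpoly) set"
  where "boundaries P J i = boundary_map P i ` chains P J (Suc i)"

definition homogeneous_chain :: "('n, 'k::comm_ring_1) free_complex \<Rightarrow> nat \<Rightarrow> 'n expo
    \<Rightarrow> (nat \<Rightarrow> ('n, 'k) mpoly) \<Rightarrow> bool"
  where "homogeneous_chain P i a v \<longleftrightarrow>
    (\<forall>b<rank P i. \<forall>m\<in>Poly_Mapping.keys (v b). m + shift P i b = a)"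

text \<open>The action of the polynomial ring on the residue field is through the constant coefficient.\<close>

definition aug_map :: "('n, 'k::comm_ring_1) free_complex \<Rightarrow> (nat \<Rightarrow> ('n, 'k) mpoly) \<Rightarrow> 'k"
  where "aug_map P v = (\<Sum>b<rank P 0. Poly_Mapping.lookup (v b) 0 * aug P b)"

definition graded_free_resolution :: "('n, 'k::comm_ring_1) free_complex \<Rightarrow> bool"
  where "graded_free_resolution P \<longleftrightarrow>
    \<comment> \<open>the differentials and the augmentation have degree 0\<close>
    (\<forall>i. \<forall>b<rank P (Suc i). \<forall>c<rank P i. \<forall>m\<in>Poly_Mapping.keys (diff P i b c).
       m + shift P i c = shift P (Suc i) b) \<and>
    (\<forall>b<rank P 0. aug P b \<noteq> 0 \<longrightarrow> shift P 0 b = 0) \<and>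
    \<comment> \<open>exactness at the residue field, at \<open>P\<^sub>0\<close> and at the higher \<open>P\<^sub>i\<close>\<close>
    aug_map P ` chains P UNIV 0 = UNIV \<and>
    {v \<in> chains P UNIV 0. aug_map P v = 0} = boundaries P UNIV 0 \<and>
    (\<forall>i. cycles P UNIV (Suc i) = boundaries P UNIV (Suc i))"

text \<open>
  The degree-\<open>a\<close> component of \<open>Tor\<^sub>i(K, J) = H\<^sub>i(P \<otimes> J)\<close> is nonzero, where \<open>P\<close> is a graded free
  resolution of the residue field \<open>K\<close>. Up to isomorphism the homology does not depend on \<open>P\<close>;
  a resolution exists by \<open>ex_graded_free_resolution\<close> below.
\<close>

definition Tor_nonzero :: "nat \<Rightarrow> ('n, 'k::field) mpoly set \<Rightarrow> 'n expo \<Rightarrow> bool"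
  where "Tor_nonzero i J a \<longleftrightarrow>
    (\<exists>P. graded_free_resolution P \<and>
      (\<exists>z \<in> cycles P J i. homogeneous_chain P i a z \<and> z \<notin> boundaries P J i))"

definition HS :: "nat \<Rightarrow> ('n, 'k::field) mpoly set \<Rightarrow> ('n, 'k) mpoly set"
  where "HS i J = ideal_of {monom a | a. Tor_nonzero i J a}"


subsection \<open>The Koszul complex\<close>

text \<open>
  Existence of a resolution: the Koszul complex on the variables. Its exactness is shown on
  functions indexed by finite sets of variables, with the contracting homotopy that, in each
  multidegree, adds the variable of the support which is least for the injection \<open>pos\<close>.
\<close>

definition ksign :: "('n \<Rightarrow> nat) \<Rightarrow> 'n \<Rightarrow> 'n set \<Rightarrow> 'k::comm_ring_1"
  where "ksign pos j G = (-1) ^ card {l \<in> G. pos l < pos j}"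

definition kcoeff :: "('n \<Rightarrow> nat) \<Rightarrow> 'n \<Rightarrow> 'n set \<Rightarrow> ('n, 'k::comm_ring_1) mpoly"
  where "kcoeff pos j G = Poly_Mapping.single (unit_expo j) (ksign pos j G)"

definition koszul_map ::
    "('n::finite \<Rightarrow> nat) \<Rightarrow> ('n set \<Rightarrow> ('n, 'k::comm_ring_1) mpoly) \<Rightarrow> 'n set \<Rightarrow> ('n, 'k) mpoly"
  where "koszul_map pos v G = (\<Sum>j\<in>-G. v (insert j G) * kcoeff pos j G)"

definition least_in :: "('n \<Rightarrow> nat) \<Rightarrow> 'n set \<Rightarrow> 'n"
  where "least_in pos A = (ARG_MIN pos j. j \<in> A)"

definition koszul_homotopy ::
    "('n \<Rightarrow> nat) \<Rightarrow> ('n set \<Rightarrow> ('n, 'k::comm_ring_1) mpoly) \<Rightarrow> 'n set \<Rightarrow> ('n, 'k) mpoly"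
  where "koszul_homotopy pos v F = Abs_poly_mapping (\<lambda>m.
    let j = least_in pos (F \<union> Poly_Mapping.keys m)
    in if j \<in> F then Poly_Mapping.lookup (v (F - {j})) (m + unit_expo j) else 0)"

context
  notes One_nat_def [simp del]
begin

lemma lookup_times_single:
  fixes f :: "('n, 'k::comm_ring_1) mpoly"
  shows "Poly_Mapping.lookup (f * Poly_Mapping.single (unit_expo j) c) m =
    (if Poly_Mapping.lookup m j > 0 then Poly_Mapping.lookup f (m - unit_expo j) * c else 0)"
proof -
  have "Poly_Mapping.lookup (f * Poly_Mapping.single (unit_expo j) c) m =
      (\<Sum>l. Poly_Mapping.lookup f l * (\<Sum>q. (c when unit_expo j = q) when m = l + q))"
    by (simp add: lookup_mult lookup_single)
  also have "\<dots> = (\<Sum>l. Poly_Mapping.lookup f l * (c when m = l + unit_expo j))"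
  proof -
    have "(\<Sum>q. (c when unit_expo j = q) when m = l + q) = (c when m = l + unit_expo j)" for l
    proof -
      have "(\<Sum>q. (c when unit_expo j = q) when m = l + q)
          = (\<Sum>q. (c when m = l + q) when q = unit_expo j)"
        by (rule Sum_any.cong) (auto simp: when_def)
      then show ?thesis by simp
    qed
    then show ?thesis by simp
  qed
  also have "\<dots> = (if Poly_Mapping.lookup m j > 0
      then Poly_Mapping.lookup f (m - unit_expo j) * c else 0)"
  proof (cases "Poly_Mapping.lookup m j > 0")
    case True
    have eq: "m = l + unit_expo j \<longleftrightarrow> l = m - unit_expo j" for l
    proof
      assume "l = m - unit_expo j"
      then show "m = l + unit_expo j"
        using True by (intro poly_mapping_eqI)
          (auto simp: lookup_add lookup_minus lookup_single when_def)
    qed simp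
    have "(\<Sum>l. Poly_Mapping.lookup f l * (c when m = l + unit_expo j))
        = (\<Sum>l. (Poly_Mapping.lookup f l * c) when l = m - unit_expo j)"
      by (rule Sum_any.cong) (auto simp: eq when_def)
    also have "\<dots> = Poly_Mapping.lookup f (m - unit_expo j) * c"
      by (rule Sum_any_when_equal)
    finally show ?thesis using True by simp
  next
    case False
    then have "m \<noteq> l + unit_expo j" for l
      by (auto simp: lookup_add)
    then show ?thesis using False by simp
  qed
  finally show ?thesis .
qed

lemma lookup_koszul_map:
  "Poly_Mapping.lookup (koszul_map pos v G) m =
    (\<Sum>j\<in>-G. if Poly_Mapping.lookup m j > 0
      then Poly_Mapping.lookup (v (insert j G)) (m - unit_expo j) * ksign pos j G else 0)"
  by (simp add: koszul_map_def kcoeff_def lookup_sum lookup_times_single)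

lemma lookup_koszul_homotopy:
  fixes F :: "'n::finite set"
  shows "Poly_Mapping.lookup (koszul_homotopy pos v F) m =
    (let j = least_in pos (F \<union> Poly_Mapping.keys m)
     in if j \<in> F then Poly_Mapping.lookup (v (F - {j})) (m + unit_expo j) else 0)"
proof -
  let ?f = "\<lambda>m. let j = least_in pos (F \<union> Poly_Mapping.keys m)
    in if j \<in> F then Poly_Mapping.lookup (v (F - {j})) (m + unit_expo j) else 0"
  have "{m. ?f m \<noteq> 0} \<subseteq>
      (\<Union>j. (\<lambda>m. m + unit_expo j) -` Poly_Mapping.keys (v (F - {j})))"
    by (auto simp: Let_def in_keys_iff split: if_splits)
  moreover have "finite (\<Union>j. (\<lambda>m. m + unit_expo j) -` Poly_Mapping.keys (v (F - {j})))"
    by (intro finite_UN_I finite_vimageI) (auto intro: injI)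
  ultimately have "finite {m. ?f m \<noteq> 0}" by (rule finite_subset)
  then show ?thesis
    unfolding koszul_homotopy_def by (subst lookup_Abs_poly_mapping) auto
qed

lemma ksign_insert:
  fixes G :: "'n::finite set"
  assumes "k \<notin> G"
  shows "ksign pos j (insert k G) = (if pos k < pos j then - ksign pos j G else ksign pos j G)"
proof -
  have "{l \<in> insert k G. pos l < pos j} =
      (if pos k < pos j then insert k {l \<in> G. pos l < pos j} else {l \<in> G. pos l < pos j})"
    by auto
  then show ?thesis using assms by (simp add: ksign_def)
qed

lemma koszul_map_koszul_map:
  fixes v :: "'n::finite set \<Rightarrow> ('n, 'k::comm_ring_1) mpoly"
  assumes pos: "inj pos"
  shows "koszul_map pos (koszul_map pos v) G = 0"
proof -
  define T where "T = (\<lambda>j k. v (insert k (insert j G)) * kcoeff pos k (insert j G) * kcoeff pos j G)"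
  have anti: "T j k = - T k j" if "j \<in> -G" "k \<in> -G" "j \<noteq> k" for j k
  proof -
    have "pos j \<noteq> pos k" using that pos by (auto dest: injD)
    then have sgn: "ksign pos k (insert j G) * ksign pos j G
        = - (ksign pos j (insert k G) * ksign pos k G :: 'k)"
      using that by (auto simp: ksign_insert)
    have exps: "unit_expo k + unit_expo j = unit_expo j + unit_expo k"
      by (rule add.commute)
    have "kcoeff pos k (insert j G) * kcoeff pos j G
        = - (kcoeff pos j (insert k G) * kcoeff pos k G :: ('n, 'k) mpoly)"
      unfolding kcoeff_def mult_single sgn exps by (rule single_uminus)
    then show ?thesis
      unfolding T_def mult.assoc insert_commute[of j k] by simp
  qed
  have "koszul_map pos (koszul_map pos v) G = (\<Sum>j\<in>-G. \<Sum>k\<in>-insert j G. T j k)"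
    by (simp add: koszul_map_def T_def sum_distrib_right)
  also have "\<dots> = (\<Sum>j\<in>-G. (\<Sum>k | k \<in> -G \<and> pos j < pos k. T j k) + (\<Sum>k | k \<in> -G \<and> pos k < pos j. T j k))"
  proof (rule sum.cong[OF refl])
    fix j assume "j \<in> -G"
    have split: "-insert j G = {k. k \<in> -G \<and> pos j < pos k} \<union> {k. k \<in> -G \<and> pos k < pos j}"
    proof -
      have "k = j \<longleftrightarrow> \<not> (pos j < pos k \<or> pos k < pos j)" for k
        using inj_eq[OF pos, of k j] by auto
      with \<open>j \<in> -G\<close> show ?thesis by auto
    qed
    show "(\<Sum>k\<in>-insert j G. T j k) =
        (\<Sum>k | k \<in> -G \<and> pos j < pos k. T j k) + (\<Sum>k | k \<in> -G \<and> pos k < pos j. T j k)"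
      unfolding split by (rule sum.union_disjoint) auto
  qed
  also have "\<dots> = (\<Sum>j\<in>-G. \<Sum>k | k \<in> -G \<and> pos j < pos k. T j k)
      + (\<Sum>j\<in>-G. \<Sum>k | k \<in> -G \<and> pos k < pos j. T j k)"
    by (simp add: sum.distrib)
  also have "(\<Sum>j\<in>-G. \<Sum>k | k \<in> -G \<and> pos k < pos j. T j k)
      = (\<Sum>k\<in>-G. \<Sum>j | j \<in> -G \<and> pos k < pos j. T j k)"
    by (rule sum.swap_restrict) auto
  also have "\<dots> = (\<Sum>k\<in>-G. \<Sum>j | j \<in> -G \<and> pos k < pos j. - T k j)"
    by (intro sum.cong refl anti) auto
  finally show ?thesis by (simp add: sum_negf)
qed

lemma koszul_homotopy_identity:
  fixes v :: "'n::finite set \<Rightarrow> ('n, 'k::comm_ring_1) mpoly"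
  assumes pos: "inj pos" and ne: "G \<union> Poly_Mapping.keys m \<noteq> {}"
  shows "Poly_Mapping.lookup (koszul_map pos (koszul_homotopy pos v) G) m
    + Poly_Mapping.lookup (koszul_homotopy pos (koszul_map pos v) G) m = Poly_Mapping.lookup (v G) m"
proof -
  define i where "i = least_in pos (G \<union> Poly_Mapping.keys m)"
  have i: "i \<in> G \<union> Poly_Mapping.keys m" and le: "pos i \<le> pos j" if "j \<in> G \<union> Poly_Mapping.keys m" for j
    using arg_min_nat_lemma[of "\<lambda>j. j \<in> G \<union> Poly_Mapping.keys m" j pos] that
    by (auto simp: i_def least_in_def)
  from ne i have i: "i \<in> G \<union> Poly_Mapping.keys m" by blast
  have same: "insert j G \<union> Poly_Mapping.keys (m - unit_expo j) = G \<union> Poly_Mapping.keys m"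
    if "Poly_Mapping.lookup m j > 0" for j
    using that by (auto simp: in_keys_iff lookup_minus lookup_single when_def split: if_splits)
  then have lst: "least_in pos (insert j (G \<union> Poly_Mapping.keys (m - unit_expo j))) = i"
    if "Poly_Mapping.lookup m j > 0" for j
    using that by (simp add: i_def)
  have sgn1: "ksign pos i (G - {i}) = (1 :: 'k)"
  proof -
    have "{l \<in> G - {i}. pos l < pos i} = {}" using le by (auto simp: not_less)
    then show ?thesis by (simp add: ksign_def del: Collect_empty_eq)
  qed
  have A: "Poly_Mapping.lookup (koszul_map pos (koszul_homotopy pos v) G) m =
    (\<Sum>j\<in>-G. if Poly_Mapping.lookup m j > 0 \<and> i \<in> insert j G
      then Poly_Mapping.lookup (v (insert j G - {i})) (m - unit_expo j + unit_expo i) * ksign pos j G else 0)"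
    unfolding lookup_koszul_map
    by (intro sum.cong refl) (simp add: lookup_koszul_homotopy lst Let_def)
  show ?thesis
  proof (cases "i \<in> G")
    case False
    with i have mi: "Poly_Mapping.lookup m i > 0" by (simp add: in_keys_iff)
    have "(\<Sum>j\<in>-G. if Poly_Mapping.lookup m j > 0 \<and> i \<in> insert j G
      then Poly_Mapping.lookup (v (insert j G - {i})) (m - unit_expo j + unit_expo i) * ksign pos j G else 0)
      = (\<Sum>j\<in>-G. if j = i then Poly_Mapping.lookup (v G) m else 0)"
    proof (intro sum.cong refl)
      fix j assume "j \<in> -G"
      have "m - unit_expo i + unit_expo i = m"
        using mi by (intro poly_mapping_eqI) (auto simp: lookup_add lookup_minus lookup_single when_def)
      then show "(if Poly_Mapping.lookup m j > 0 \<and> i \<in> insert j G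
      then Poly_Mapping.lookup (v (insert j G - {i})) (m - unit_expo j + unit_expo i) * ksign pos j G else 0)
       = (if j = i then Poly_Mapping.lookup (v G) m else 0)"
        using False mi sgn1 by auto
    qed
    also have "\<dots> = Poly_Mapping.lookup (v G) m" using False by simp
    finally show ?thesis
      using False unfolding A lookup_koszul_homotopy by (simp add: Let_def flip: i_def)
  next
    case True
    define H where "H = G - {i}"
    have H: "i \<notin> H" "G = insert i H" "-H = insert i (-G)" using True by (auto simp: H_def)
    have "Poly_Mapping.lookup (koszul_homotopy pos (koszul_map pos v) G) m =
      Poly_Mapping.lookup (koszul_map pos v H) (m + unit_expo i)"
      using True by (simp add: lookup_koszul_homotopy Let_def H_def flip: i_def)
    also have "\<dots> = Poly_Mapping.lookup (v G) m + (\<Sum>j\<in>-G.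
        if Poly_Mapping.lookup (m + unit_expo i) j > 0
        then Poly_Mapping.lookup (v (insert j H)) (m + unit_expo i - unit_expo j) * ksign pos j H else 0)"
      using H sgn1 True by (simp add: lookup_koszul_map lookup_add flip: H_def)
    also have "(\<Sum>j\<in>-G. if Poly_Mapping.lookup (m + unit_expo i) j > 0
        then Poly_Mapping.lookup (v (insert j H)) (m + unit_expo i - unit_expo j) * ksign pos j H else 0)
      = (\<Sum>j\<in>-G. - (if Poly_Mapping.lookup m j > 0 \<and> i \<in> insert j G
      then Poly_Mapping.lookup (v (insert j G - {i})) (m - unit_expo j + unit_expo i) * ksign pos j G else 0))"
    proof (intro sum.cong refl)
      fix j assume j: "j \<in> -G"
      with True have ji: "j \<noteq> i" by auto
      have gt: "Poly_Mapping.lookup (m + unit_expo i) j = Poly_Mapping.lookup m j"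
        using ji by (simp add: lookup_add lookup_single)
      have sets: "insert j G - {i} = insert j H" using H ji by auto
      show "(if Poly_Mapping.lookup (m + unit_expo i) j > 0
        then Poly_Mapping.lookup (v (insert j H)) (m + unit_expo i - unit_expo j) * ksign pos j H else 0)
      = - (if Poly_Mapping.lookup m j > 0 \<and> i \<in> insert j G
      then Poly_Mapping.lookup (v (insert j G - {i})) (m - unit_expo j + unit_expo i) * ksign pos j G else 0)"
      proof (cases "Poly_Mapping.lookup m j > 0")
        case pj: True
        have e: "m + unit_expo i - unit_expo j = m - unit_expo j + unit_expo i"
          using pj ji by (intro poly_mapping_eqI) (auto simp: lookup_add lookup_minus lookup_single when_def)
        have "pos i < pos j"
          using le[of j] pj pos ji by (auto simp: in_keys_iff le_less dest: injD)
        then have "ksign pos j G = - (ksign pos j H :: 'k)"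
          using ksign_insert[OF H(1), of pos j] H(2) by simp
        then show ?thesis using pj True by (simp add: gt sets e)
      next
        case False
        then show ?thesis by (simp add: gt)
      qed
    qed
    finally show ?thesis unfolding A by (simp add: sum_negf)
  qed
qed

end

lemma ex_graded_free_resolution:
  "\<exists>P :: ('n::finite, 'k::field) free_complex. graded_free_resolution P"
proof -
  obtain pos :: "'n \<Rightarrow> nat" where pos: "inj pos"
    using finite_imp_inj_to_nat_seg[of "UNIV :: 'n set"] by auto
  define r where "r i = card {F :: 'n set. card F = i}" for i
  have "\<exists>e. bij_betw e {..<r i} {F :: 'n set. card F = i}" for i
    using ex_bij_betw_nat_finite[of "{F :: 'n set. card F = i}"]
    by (simp add: r_def lessThan_atLeast0)
  then obtain e where e: "\<And>i. bij_betw (e i) {..<r i} {F :: 'n set. card F = i}"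
    by metis
  define ix where "ix F = the_inv_into {..<r (card F)} (e (card F)) F" for F
  have card_e: "card (e i b) = i" if "b < r i" for i b
    using bij_betwE[OF e[of i]] that by auto
  have ix_e [simp]: "ix (e i b) = b" if "b < r i" for i b
    using the_inv_into_f_f[OF bij_betw_imp_inj_on[OF e[of i]], of b] that
    by (simp add: ix_def card_e)
  have ix_less: "ix F < r (card F)" and e_ix: "e (card F) (ix F) = F" for F
    using f_the_inv_into_f_bij_betw[OF e[of "card F"], of F]
      the_inv_into_into[OF bij_betw_imp_inj_on[OF e[of "card F"]], of F "{..<r (card F)}"]
      bij_betw_imp_surj_on[OF e[of "card F"]]
    by (auto simp: ix_def)
  define P :: "('n, 'k) free_complex" where "P = \<lparr>
     rank = r,
     shift = (\<lambda>i b. \<Sum>j\<in>e i b. unit_expo j),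
     diff = (\<lambda>i b c. \<Sum>j\<in>-e i c. if e (Suc i) b = insert j (e i c) then kcoeff pos j (e i c) else 0),
     aug = (\<lambda>_. 1) \<rparr>"
  define ext :: "nat \<Rightarrow> (nat \<Rightarrow> ('n, 'k) mpoly) \<Rightarrow> 'n set \<Rightarrow> ('n, 'k) mpoly"
    where "ext i v F = (if card F = i then v (ix F) else 0)" for i v F
  have bd: "boundary_map P i v c = (if c < r i then koszul_map pos (ext (Suc i) v) (e i c) else 0)" for i v c
  proof (cases "c < r i")
    case c: True
    have "boundary_map P i v c = (\<Sum>b<r (Suc i). \<Sum>j\<in>-e i c.
        v b * (if e (Suc i) b = insert j (e i c) then kcoeff pos j (e i c) else 0))"
      using c by (simp add: boundary_map_def P_def sum_distrib_left)
    also have "\<dots> = (\<Sum>j\<in>-e i c. \<Sum>b<r (Suc i).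
        v b * (if e (Suc i) b = insert j (e i c) then kcoeff pos j (e i c) else 0))"
      by (rule sum.swap)
    also have "\<dots> = (\<Sum>j\<in>-e i c. ext (Suc i) v (insert j (e i c)) * kcoeff pos j (e i c))"
    proof (intro sum.cong refl)
      fix j assume j: "j \<in> -e i c"
      have cardj: "card (insert j (e i c)) = Suc i" using j card_e[OF c] by simp
      have iff: "e (Suc i) b = insert j (e i c) \<longleftrightarrow> b = ix (insert j (e i c))" if "b < r (Suc i)" for b
        using e_ix[of "insert j (e i c)"] cardj ix_e[OF that] by metis
      have "(\<Sum>b<r (Suc i). v b * (if e (Suc i) b = insert j (e i c) then kcoeff pos j (e i c) else 0))
        = (\<Sum>b<r (Suc i). if b = ix (insert j (e i c)) then v b * kcoeff pos j (e i c) else 0)"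
        by (intro sum.cong refl) (simp add: iff)
      also have "\<dots> = ext (Suc i) v (insert j (e i c)) * kcoeff pos j (e i c)"
        using ix_less[of "insert j (e i c)"] unfolding ext_def cardj by simp
      finally show "(\<Sum>b<r (Suc i). v b * (if e (Suc i) b = insert j (e i c) then kcoeff pos j (e i c) else 0))
        = ext (Suc i) v (insert j (e i c)) * kcoeff pos j (e i c)" .
    qed
    finally show ?thesis using c by (simp add: koszul_map_def)
  qed (simp add: boundary_map_def P_def)
  have ch: "v \<in> chains P UNIV i \<longleftrightarrow> (\<forall>b\<ge>r i. v b = 0)" for v i
    by (simp add: chains_def P_def)
  have ext_bd: "ext i (boundary_map P i v) = koszul_map pos (ext (Suc i) v)" for i v
  proof
    fix F
    show "ext i (boundary_map P i v) F = koszul_map pos (ext (Suc i) v) F"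
    proof (cases "card F = i")
      case True
      then show ?thesis using ix_less[of F] e_ix[of F] by (auto simp: ext_def bd)
    next
      case False
      then have "koszul_map pos (ext (Suc i) v) F = 0"
        unfolding koszul_map_def by (intro sum.neutral) (auto simp: ext_def)
      then show ?thesis using False by (simp add: ext_def)
    qed
  qed
  have bd_bd: "boundary_map P i (boundary_map P (Suc i) v) = (\<lambda>_. 0)" for i v
    by (rule ext) (simp add: bd ext_bd koszul_map_koszul_map[OF pos])
  have exact: "v \<in> boundaries P UNIV i"
    if v: "v \<in> chains P UNIV i"
      and h: "\<And>F. card F = i \<Longrightarrow> koszul_map pos (koszul_homotopy pos (ext i v)) F = ext i v F" for v i
  proof -
    define w where "w b = (if b < r (Suc i) then koszul_homotopy pos (ext i v) (e (Suc i) b) else 0)" for b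
    have "boundary_map P i w c = v c" for c
    proof (cases "c < r i")
      case c: True
      have "ext (Suc i) w (insert j (e i c)) = koszul_homotopy pos (ext i v) (insert j (e i c))"
        if "j \<in> -e i c" for j
      proof -
        have "card (insert j (e i c)) = Suc i" using that card_e[OF c] by simp
        then show ?thesis
          using ix_less[of "insert j (e i c)"] e_ix[of "insert j (e i c)"]
          by (simp add: ext_def w_def)
      qed
      then have "koszul_map pos (ext (Suc i) w) (e i c) =
          koszul_map pos (koszul_homotopy pos (ext i v)) (e i c)"
        by (simp add: koszul_map_def)
      also have "\<dots> = v c" using h[OF card_e[OF c]] c by (simp add: ext_def card_e)
      finally show ?thesis using c by (simp add: bd)
    next
      case False
      then show ?thesis using v by (simp add: bd ch)
    qed
    then have "v = boundary_map P i w" by auto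
    moreover have "w \<in> chains P UNIV (Suc i)" by (simp add: ch w_def)
    ultimately show ?thesis by (auto simp: boundaries_def)
  qed
  have hom0: "koszul_homotopy pos (\<lambda>_. 0) G = (0 :: ('n, 'k) mpoly)" for G
    by (intro poly_mapping_eqI) (simp add: lookup_koszul_homotopy Let_def)
  have card0: "{F :: 'n set. card F = 0} = {{}}" by auto
  have r0: "r 0 = 1" unfolding r_def card0 by simp
  have e0: "e 0 0 = {}" using card_e[of 0 0] r0 by simp
  have ix0: "ix {} = 0" using ix_e[of 0 0] r0 e0 by simp
  have aug: "aug_map P v = Poly_Mapping.lookup (v 0) 0" for v
    by (simp add: aug_map_def P_def r0)
  have degrees: "m + shift P i c = shift P (Suc i) b"
    if "b < rank P (Suc i)" "c < rank P i" "m \<in> Poly_Mapping.keys (diff P i b c)" for i b c m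
  proof -
    from that(3) obtain j where j: "j \<in> -e i c"
        "m \<in> Poly_Mapping.keys (if e (Suc i) b = insert j (e i c) then kcoeff pos j (e i c) else (0 :: ('n, 'k) mpoly))"
      using keys_sum by (fastforce simp: P_def)
    then have "e (Suc i) b = insert j (e i c)" "m = unit_expo j"
      by (auto simp: kcoeff_def split: if_splits)
    then show ?thesis using j by (simp add: P_def)
  qed
  have ex1: "cycles P UNIV (Suc i) = boundaries P UNIV (Suc i)" for i
  proof
    show "boundaries P UNIV (Suc i) \<subseteq> cycles P UNIV (Suc i)"
      by (auto simp: boundaries_def ch bd_bd) (simp add: bd)
    show "cycles P UNIV (Suc i) \<subseteq> boundaries P UNIV (Suc i)"
    proof
      fix v assume "v \<in> cycles P UNIV (Suc i)"
      then have v: "v \<in> chains P UNIV (Suc i)" "boundary_map P i v = (\<lambda>_. 0)" by auto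
      have "ext i (\<lambda>_. 0) = (\<lambda>_. 0)" by (auto simp: ext_def)
      then have 0: "koszul_map pos (ext (Suc i) v) = (\<lambda>_. 0)"
        using ext_bd[of i v] unfolding v(2) by simp
      show "v \<in> boundaries P UNIV (Suc i)"
      proof (rule exact[OF v(1)])
        fix F :: "'n set" assume F: "card F = Suc i"
        show "koszul_map pos (koszul_homotopy pos (ext (Suc i) v)) F = ext (Suc i) v F"
        proof (rule poly_mapping_eqI)
          fix m :: "'n expo"
          have "F \<union> Poly_Mapping.keys m \<noteq> {}" using F by auto
          from koszul_homotopy_identity[OF pos this, of "ext (Suc i) v"]
          show "Poly_Mapping.lookup (koszul_map pos (koszul_homotopy pos (ext (Suc i) v)) F) m
            = Poly_Mapping.lookup (ext (Suc i) v F) m"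
            by (simp add: 0 hom0)
        qed
      qed
    qed
  qed
  have const0: "Poly_Mapping.lookup (koszul_map pos u G) 0 = 0" for u :: "'n set \<Rightarrow> ('n, 'k) mpoly" and G
    by (simp add: lookup_koszul_map)
  have ex0: "{v \<in> chains P UNIV 0. aug_map P v = 0} = boundaries P UNIV 0"
  proof
    show "boundaries P UNIV 0 \<subseteq> {v \<in> chains P UNIV 0. aug_map P v = 0}"
      by (auto simp: boundaries_def ch aug bd const0)
    show "{v \<in> chains P UNIV 0. aug_map P v = 0} \<subseteq> boundaries P UNIV 0"
    proof
      fix v assume "v \<in> {v \<in> chains P UNIV 0. aug_map P v = 0}"
      then have v: "v \<in> chains P UNIV 0" "Poly_Mapping.lookup (v 0) 0 = 0" by (auto simp: aug)
      show "v \<in> boundaries P UNIV 0"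
      proof (rule exact[OF v(1)])
        fix F :: "'n set" assume "card F = 0"
        then have F: "F = {}" by simp
        show "koszul_map pos (koszul_homotopy pos (ext 0 v)) F = ext 0 v F"
        proof (rule poly_mapping_eqI)
          fix m :: "'n expo"
          show "Poly_Mapping.lookup (koszul_map pos (koszul_homotopy pos (ext 0 v)) F) m
            = Poly_Mapping.lookup (ext 0 v F) m"
          proof (cases "m = 0")
            case True
            then show ?thesis using v(2) by (simp add: const0 ext_def F ix0)
          next
            case False
            then have "F \<union> Poly_Mapping.keys m \<noteq> {}"
              by simp
            from koszul_homotopy_identity[OF pos this, of "ext 0 v"]
            show ?thesis by (simp add: lookup_koszul_homotopy[where F = "{}"] F Let_def)
          qed
        qed
      qed
    qed
  qed
  have onto: "aug_map P ` chains P UNIV 0 = UNIV"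
  proof -
    have "c \<in> aug_map P ` chains P UNIV 0" for c
    proof
      show "c = aug_map P (\<lambda>b. if b = 0 then Poly_Mapping.single 0 c else 0)" by (simp add: aug)
      show "(\<lambda>b. if b = 0 then Poly_Mapping.single 0 c else 0) \<in> chains P UNIV 0"
        by (simp add: ch r0)
    qed
    then show ?thesis by blast
  qed
  have "shift P 0 b = 0" if "b < rank P 0" for b
    using that by (simp add: P_def r0 e0)
  with degrees ex0 ex1 onto have "graded_free_resolution P"
    unfolding graded_free_resolution_def by blast
  then show ?thesis ..
qed

end

theory Submission
  imports Defs
begin

text \<open>
  Let \<open>B\<close> be the set of exponents of the minimal generators of \<open>I\<close> and \<open>kB\<close> its \<open>k\<close>-fold sumset, which
  again has the exchange property. For such a set of generators the multidegrees of \<open>Tor\<^sub>1\<close> generate the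
  ideal of all monomials with at least two divisors in \<open>kB\<close>: a linear syzygy gives a nonzero class,
  the exchange property produces linear syzygies below any two generators, and there is no class
  in a degree above only one generator.

  Strong persistence of the powers of \<open>I\<close> holds because a monomial \<open>c\<close> outside \<open>I\<^sup>k\<close> is separated from
  \<open>kB\<close> by a set \<open>A\<close> of variables: its degree in \<open>A\<close> is too small, and this remains so after
  multiplication by a generator of minimal degree in \<open>A\<close>. The monomials with a unique divisor
  are handled by a generator that is maximal in the relevant variables.
\<close>

section \<open>Sets of exponents with the exchange property\<close>

text \<open>Keeps the simplifier from turning the \<open>1\<close> inside \<open>unit_expo\<close>
  into \<open>Suc 0\<close>, after which rules about \<open>unit_expo\<close> would no longer
  match.\<close>

context
  notes One_nat_def [simp del]
begin

definition exponent_degree :: "'n::finite expo \<Rightarrow> nat"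
  where "exponent_degree a = (\<Sum>i\<in>UNIV. Poly_Mapping.lookup a i)"

definition exponent_le :: "'n expo \<Rightarrow> 'n expo \<Rightarrow> bool"
  where "exponent_le a b \<longleftrightarrow> (\<forall>i. Poly_Mapping.lookup a i \<le> Poly_Mapping.lookup b i)"

text \<open>An equation between sums describes the exchanged vector, so that truncated subtraction
  never enters. Equality of degrees is kept as a separate hypothesis.\<close>

definition exchange :: "'n expo set \<Rightarrow> bool"
  where "exchange B \<longleftrightarrow> (\<forall>u\<in>B. \<forall>v\<in>B. \<forall>i. Poly_Mapping.lookup v i < Poly_Mapping.lookup u i \<longrightarrow>
    (\<exists>j. Poly_Mapping.lookup u j < Poly_Mapping.lookup v j \<and> (\<exists>w\<in>B. w + unit_expo i = u + unit_expo j)))"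

definition sumset :: "'n expo set \<Rightarrow> 'n expo set \<Rightarrow> 'n expo set"
  where "sumset A B = {a + b | a b. a \<in> A \<and> b \<in> B}"

fun iterated_sumset :: "nat \<Rightarrow> 'n expo set \<Rightarrow> 'n expo set" where
  "iterated_sumset 0 B = {0}"
| "iterated_sumset (Suc k) B = sumset B (iterated_sumset k B)"

text \<open>By truncation, coordinates where \<open>u\<close> lies below \<open>v\<close> count
  zero. This is the induction measure of all exchange arguments.\<close>

definition excess :: "'n::finite expo \<Rightarrow> 'n expo \<Rightarrow> nat"
  where "excess u v = (\<Sum>i\<in>UNIV. Poly_Mapping.lookup u i - Poly_Mapping.lookup v i)"

lemma exponent_le_iff: "exponent_le b a \<longleftrightarrow> (\<exists>c. a = b + c)"
proof
  assume "exponent_le b a"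
  then have "a = b + (a - b)"
    by (intro poly_mapping_eqI) (simp add: exponent_le_def lookup_add lookup_minus)
  then show "\<exists>c. a = b + c" ..
qed (auto simp: exponent_le_def lookup_add)

lemma exponent_degree_add [simp]:
  "exponent_degree (a + b) = exponent_degree a + exponent_degree b"
  by (simp add: exponent_degree_def lookup_add sum.distrib)

lemma exponent_degree_zero [simp]: "exponent_degree 0 = 0"
  by (simp add: exponent_degree_def)

lemma exponent_degree_unit_expo [simp]: "exponent_degree (unit_expo i) = 1"
  by (simp add: exponent_degree_def lookup_single when_def)

lemma exponent_degree_mono: "exponent_le a b \<Longrightarrow> exponent_degree a \<le> exponent_degree b"
  by (simp add: exponent_degree_def exponent_le_def sum_mono)

lemma lookup_le_exponent_degree: "Poly_Mapping.lookup a i \<le> exponent_degree a"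
  unfolding exponent_degree_def by (rule member_le_sum) auto

lemma exponent_le_antisym_degree:
  assumes "exponent_le a b" "exponent_degree a = exponent_degree b"
  shows "a = b"
proof -
  obtain c where c: "b = a + c" using assms(1) by (auto simp: exponent_le_iff)
  have "exponent_degree c = 0" using assms(2) c by simp
  then have "c = 0" by (intro poly_mapping_eqI) (simp add: exponent_degree_def)
  then show ?thesis using c by simp
qed

text \<open>The step lowers a coordinate where \<open>u\<close> exceeds \<open>v\<close>, and the
  coordinate it raises still does not exceed that of \<open>v\<close>.\<close>

lemma excess_exchange_less:
  assumes w: "w + unit_expo i = u + unit_expo j"
    and i: "Poly_Mapping.lookup v i < Poly_Mapping.lookup u i"
    and j: "Poly_Mapping.lookup u j < Poly_Mapping.lookup v j"
  shows "excess w v < excess u v"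
proof -
  have lw: "Poly_Mapping.lookup w k + (if k = i then 1 else 0) = Poly_Mapping.lookup u k + (if k = j then 1 else 0)" for k
    using arg_cong[OF w, of "\<lambda>x. Poly_Mapping.lookup x k"]
    by (auto simp: lookup_add lookup_single when_def)
  have "i \<noteq> j" using i j by auto
  show ?thesis unfolding excess_def
  proof (rule sum_strict_mono_ex1)
    show "\<forall>k\<in>UNIV. Poly_Mapping.lookup w k - Poly_Mapping.lookup v k
        \<le> Poly_Mapping.lookup u k - Poly_Mapping.lookup v k"
    proof
      fix k
      show "Poly_Mapping.lookup w k - Poly_Mapping.lookup v k
        \<le> Poly_Mapping.lookup u k - Poly_Mapping.lookup v k"
        using lw[of k] j by (cases "k = j") (auto split: if_splits)
    qed
    show "\<exists>k\<in>UNIV. Poly_Mapping.lookup w k - Poly_Mapping.lookup v k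
        < Poly_Mapping.lookup u k - Poly_Mapping.lookup v k"
      using lw[of i] i \<open>i \<noteq> j\<close> by (intro bexI[of _ i]) auto
  qed simp
qed

section \<open>Exchange property of sumsets\<close>

text \<open>
  An exchange step in one summand moves the surplus from coordinate \<open>i\<close> to some \<open>j\<close>; if \<open>j\<close> is not
  deficient in the sum, continue from \<open>j\<close>. The total excess decreases, so this ends.
\<close>

lemma exchange_sumset:
  fixes A B :: "'n::finite expo set"
  assumes A: "exchange A" and B: "exchange B"
  shows "exchange (sumset A B)"
proof -
  have main: "\<exists>j. Poly_Mapping.lookup (u + u') j < Poly_Mapping.lookup (v + v') j \<and>
      (\<exists>w\<in>sumset A B. w + unit_expo i = u + u' + unit_expo j)"
    if "u \<in> A" "u' \<in> B" "v \<in> A" "v' \<in> B"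
      "Poly_Mapping.lookup (v + v') i < Poly_Mapping.lookup (u + u') i" for u u' v v' i
    using that
  proof (induction "excess u v + excess u' v'" arbitrary: u u' i rule: less_induct)
    case less
    obtain w w' j where w: "w \<in> A" "w' \<in> B" "w + w' + unit_expo i = u + u' + unit_expo j"
      "excess w v + excess w' v' < excess u v + excess u' v'"
    proof (cases "Poly_Mapping.lookup v i < Poly_Mapping.lookup u i")
      case True
      then obtain j w where "Poly_Mapping.lookup u j < Poly_Mapping.lookup v j" "w \<in> A"
          "w + unit_expo i = u + unit_expo j"
        using A less.prems unfolding exchange_def by meson
      with excess_exchange_less[OF this(3) True] show ?thesis
        using less.prems by (intro that[of w u' j]) (auto simp: algebra_simps)
    next
      case False
      then have i: "Poly_Mapping.lookup v' i < Poly_Mapping.lookup u' i"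
        using less.prems by (simp add: lookup_add)
      then obtain j w where "Poly_Mapping.lookup u' j < Poly_Mapping.lookup v' j" "w \<in> B"
          "w + unit_expo i = u' + unit_expo j"
        using B less.prems unfolding exchange_def by meson
      with excess_exchange_less[OF this(3) i] show ?thesis
        using less.prems by (intro that[of u w j]) (auto simp: algebra_simps)
    qed
    show ?case
    proof (cases "Poly_Mapping.lookup (u + u') j < Poly_Mapping.lookup (v + v') j")
      case True
      then show ?thesis using w by (auto simp: sumset_def)
    next
      case False
      have lw: "Poly_Mapping.lookup (w + w') k + (if k = i then 1 else 0)
          = Poly_Mapping.lookup (u + u') k + (if k = j then 1 else 0)" for k
        using arg_cong[OF w(3), of "\<lambda>x. Poly_Mapping.lookup x k"]
        by (auto simp: lookup_add lookup_single when_def)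
      show ?thesis
      proof (cases "i = j")
        case True
        then have "w + w' = u + u'" using w(3) by simp
        then show ?thesis
          using less.hyps[OF w(4,1,2), of i] less.prems by simp
      next
        case ij: False
        then have "Poly_Mapping.lookup (v + v') j < Poly_Mapping.lookup (w + w') j"
          using lw[of j] False by simp
        from less.hyps[OF w(4,1,2) less.prems(3,4) this] obtain l x
          where l: "Poly_Mapping.lookup (w + w') l < Poly_Mapping.lookup (v + v') l"
            and x: "x \<in> sumset A B" "x + unit_expo j = w + w' + unit_expo l" by blast
        \<comment> \<open>\<open>l\<close> differs from \<open>i\<close>, because at
          \<open>i\<close> the sum \<open>w + w'\<close> is still at least \<open>v + v'\<close>.
          The steps from \<open>i\<close> to \<open>j\<close> and from \<open>j\<close> to
          \<open>l\<close> then combine into one.\<close>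
        have "Poly_Mapping.lookup (u + u') l < Poly_Mapping.lookup (v + v') l"
          using lw[of l] l less.prems(5) by (auto split: if_splits)
        moreover have "x + unit_expo i = u + u' + unit_expo l"
        proof -
          have "x + unit_expo i + unit_expo j = (x + unit_expo j) + unit_expo i"
            by (simp only: ac_simps)
          also have "\<dots> = (w + w' + unit_expo i) + unit_expo l"
            unfolding x(2) by (simp only: ac_simps)
          also have "\<dots> = u + u' + unit_expo l + unit_expo j"
            unfolding w(3) by (simp only: ac_simps)
          finally have "x + unit_expo i + unit_expo j = u + u' + unit_expo l + unit_expo j" .
          then show ?thesis by simp
        qed
        ultimately show ?thesis using x(1) by blast
      qed
    qed
  qed
  show ?thesis
    unfolding exchange_def
  proof (intro ballI allI impI)
    fix x y i assume "x \<in> sumset A B" "y \<in> sumset A B" "Poly_Mapping.lookup y i < Poly_Mapping.lookup x i"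
    then show "\<exists>j. Poly_Mapping.lookup x j < Poly_Mapping.lookup y j \<and>
      (\<exists>w\<in>sumset A B. w + unit_expo i = x + unit_expo j)"
      using main unfolding sumset_def by blast
  qed
qed

lemma exchange_iterated_sumset:
  fixes B :: "'n::finite expo set"
  shows "exchange B \<Longrightarrow> exchange (iterated_sumset k B)"
proof (induction k)
  case 0
  show ?case by (simp add: exchange_def)
qed (simp add: exchange_sumset)

lemma degree_iterated_sumset:
  assumes "\<forall>u\<in>B. exponent_degree u = d" "u \<in> iterated_sumset k B"
  shows "exponent_degree u = k * d"
  using assms(2) by (induction k arbitrary: u) (auto simp: sumset_def assms(1))

text \<open>Dual exchange, where the coordinate to be raised is prescribed. Exchange steps move
  \<open>v\<close> towards \<open>u\<close> at coordinates where it exceeds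
  \<open>u + unit_expo l\<close>, preserving its surplus at \<open>l\<close>. Once \<open>v\<close>
  divides \<open>u + unit_expo l\<close>, the quotient has degree 1, and \<open>v\<close> itself is
  the required \<open>w\<close>.\<close>

lemma exchange_dual:
  fixes B :: "'n::finite expo set"
  assumes B: "exchange B" and deg: "\<forall>u\<in>B. exponent_degree u = d"
    and u: "u \<in> B" and v: "v \<in> B" and l: "Poly_Mapping.lookup u l < Poly_Mapping.lookup v l"
  shows "\<exists>i w. i \<noteq> l \<and> w \<in> B \<and> w + unit_expo i = u + unit_expo l"
  using v l
proof (induction "excess v u" arbitrary: v rule: less_induct)
  case less
  show ?case
  proof (cases "\<exists>i. Poly_Mapping.lookup (u + unit_expo l) i < Poly_Mapping.lookup v i")
    case True
    then obtain i where i: "Poly_Mapping.lookup (u + unit_expo l) i < Poly_Mapping.lookup v i" ..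
    then have i': "Poly_Mapping.lookup u i < Poly_Mapping.lookup v i" by (simp add: lookup_add)
    then obtain j w where j: "Poly_Mapping.lookup v j < Poly_Mapping.lookup u j"
        and w: "w \<in> B" "w + unit_expo i = v + unit_expo j"
      using B u less.prems unfolding exchange_def by meson
    have "Poly_Mapping.lookup u l < Poly_Mapping.lookup w l"
      using arg_cong[OF w(2), of "\<lambda>x. Poly_Mapping.lookup x l"] i less.prems
      by (auto simp: lookup_add lookup_single when_def split: if_splits)
    then show ?thesis
      using less.hyps[OF excess_exchange_less[OF w(2) i' j] w(1)] by blast
  next
    case False
    then obtain c where c: "u + unit_expo l = v + c"
      using exponent_le_iff[of v "u + unit_expo l"] by (auto simp: exponent_le_def not_less)
    have "exponent_degree c = 1"
      using arg_cong[OF c, of exponent_degree] deg u less.prems by simp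
    then have "c \<noteq> 0" by auto
    then obtain i where i: "0 < Poly_Mapping.lookup c i"
      by (metis gr0I lookup_zero poly_mapping_eqI)
    then have "exponent_le (unit_expo i) c"
      by (auto simp: exponent_le_def lookup_single when_def)
    then have ce: "c = unit_expo i"
      using exponent_le_antisym_degree[of "unit_expo i" c] \<open>exponent_degree c = 1\<close> by simp
    then have "i \<noteq> l" using c less.prems by auto
    then show ?thesis using c ce less.prems by metis
  qed
qed

section \<open>Separation by coordinates and strong persistence\<close>

text \<open>
  Enlarge \<open>c\<close> to a maximal \<open>x\<close> that is not divisible by an element of \<open>B\<close>, with coordinates capped;
  then \<open>A\<close> consists of the coordinates \<open>j\<close> that are not yet large, and for these \<open>x + unit_expo j\<close>
  is divisible by an element of \<open>B\<close>.
\<close>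

lemma separating_coordinates:
  fixes B :: "'n::finite expo set"
  assumes B: "exchange B" and deg: "\<forall>u\<in>B. exponent_degree u = d"
    and c: "\<not> (\<exists>u\<in>B. exponent_le u c)"
  shows "\<exists>A. \<forall>h\<in>B. (\<Sum>i\<in>A. Poly_Mapping.lookup c i) < (\<Sum>i\<in>A. Poly_Mapping.lookup h i)"
proof -
  \<comment> \<open>The cap bounds the degree, so a maximal \<open>x\<close> exists. It never blocks
    raising a coordinate below \<open>d\<close>, and a coordinate that is at least \<open>d\<close>
    bounds every element of \<open>B\<close> there.\<close>
  define P where "P x \<longleftrightarrow> exponent_le c x \<and> \<not> (\<exists>u\<in>B. exponent_le u x) \<and>
    (\<forall>i. Poly_Mapping.lookup x i \<le> Poly_Mapping.lookup c i + d)" for x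
  have "exponent_degree x \<le> (\<Sum>i\<in>UNIV. Poly_Mapping.lookup c i + d)" if "P x" for x
    using that unfolding exponent_degree_def P_def by (auto intro: sum_mono)
  moreover have "P c" using c by (simp add: P_def exponent_le_def)
  ultimately have "\<exists>x. P x \<and> (\<forall>y. P y \<longrightarrow> exponent_degree y \<le> exponent_degree x)"
    by (intro ex_has_greatest_nat[where b = "Suc (\<Sum>i\<in>UNIV. Poly_Mapping.lookup c i + d)"])
      (auto simp: le_imp_less_Suc)
  then obtain x where x: "P x" and max: "\<And>y. P y \<Longrightarrow> exponent_degree y \<le> exponent_degree x"
    by auto
  define A where "A = {i. Poly_Mapping.lookup x i < d}"
  have up: "\<exists>g\<in>B. exponent_le g (x + unit_expo j)" if j: "j \<in> A" for j
  proof (rule ccontr)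
    assume "\<not> ?thesis"
    moreover have "exponent_le c (x + unit_expo j)"
      using x by (simp add: P_def exponent_le_def lookup_add trans_le_add1)
    moreover have "Poly_Mapping.lookup (x + unit_expo j) i \<le> Poly_Mapping.lookup c i + d" for i
      using x j by (cases "i = j") (simp_all add: P_def A_def lookup_add lookup_single when_def)
    ultimately have "P (x + unit_expo j)"
      by (simp add: P_def)
    from max[OF this] show False by simp
  qed
  have out: "Poly_Mapping.lookup h i \<le> Poly_Mapping.lookup x i" if "h \<in> B" "i \<notin> A" for h i
  proof -
    have "Poly_Mapping.lookup h i \<le> d"
      using lookup_le_exponent_degree[of h i] deg that(1) by simp
    also have "d \<le> Poly_Mapping.lookup x i"
      using that(2) by (simp add: A_def)
    finally show ?thesis .
  qed
  \<comment> \<open>An \<open>h\<close> of such low degree in \<open>A\<close> could be moved by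
    exchange steps until it divides \<open>x\<close>.\<close>
  have False if "h \<in> B" "(\<Sum>i\<in>A. Poly_Mapping.lookup h i) \<le> (\<Sum>i\<in>A. Poly_Mapping.lookup x i)" for h
    using that
  proof (induction "excess h x" arbitrary: h rule: less_induct)
    case less
    obtain i where i: "Poly_Mapping.lookup x i < Poly_Mapping.lookup h i"
      using x less.prems unfolding P_def exponent_le_def by (meson not_less)
    then have iA: "i \<in> A" using out less.prems by (meson not_less)
    have "\<exists>j\<in>A. Poly_Mapping.lookup h j < Poly_Mapping.lookup x j"
    proof (rule ccontr)
      assume "\<not> ?thesis"
      then have "(\<Sum>i\<in>A. Poly_Mapping.lookup x i) < (\<Sum>i\<in>A. Poly_Mapping.lookup h i)"
        using i iA by (intro sum_strict_mono_ex1) (auto simp: not_less)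
      with less.prems show False by simp
    qed
    then obtain j where j: "j \<in> A" "Poly_Mapping.lookup h j < Poly_Mapping.lookup x j" by blast
    \<comment> \<open>Since \<open>x\<close> is not in \<open>B\<close>, the exchange is made
      against \<open>g\<close>. It exceeds \<open>x\<close> at most by one and only at
      \<open>j\<close>, where \<open>h\<close> is below \<open>x\<close>; hence any coordinate with
      \<open>h\<close> below \<open>g\<close> has \<open>h\<close> below \<open>x\<close>.\<close>
    then obtain g where g: "g \<in> B" "exponent_le g (x + unit_expo j)" using up by blast
    have gle: "Poly_Mapping.lookup g k \<le> Poly_Mapping.lookup x k + (if k = j then 1 else 0)" for k
      using g(2) unfolding exponent_le_def lookup_add lookup_single when_def by (auto simp: eq_commute[of j])
    have "Poly_Mapping.lookup g i < Poly_Mapping.lookup h i"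
      using gle[of i] i j by (auto split: if_splits)
    then obtain l w where l: "Poly_Mapping.lookup h l < Poly_Mapping.lookup g l"
        and w: "w \<in> B" "w + unit_expo i = h + unit_expo l"
      using B g(1) less.prems unfolding exchange_def by meson
    have l': "Poly_Mapping.lookup h l < Poly_Mapping.lookup x l"
      using gle[of l] l j by (auto split: if_splits)
    have "(\<Sum>k\<in>A. Poly_Mapping.lookup (w + unit_expo i) k) = (\<Sum>k\<in>A. Poly_Mapping.lookup (h + unit_expo l) k)"
      by (simp add: w)
    then have "(\<Sum>k\<in>A. Poly_Mapping.lookup w k) \<le> (\<Sum>k\<in>A. Poly_Mapping.lookup h k)"
      using iA by (cases "l \<in> A") (simp_all add: lookup_add lookup_single when_def sum.distrib)
    with less.hyps[OF excess_exchange_less[OF w(2) i l'] w(1)] less.prems show ?case by simp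
  qed
  moreover have "(\<Sum>i\<in>A. Poly_Mapping.lookup c i) \<le> (\<Sum>i\<in>A. Poly_Mapping.lookup x i)"
    using x by (intro sum_mono) (simp add: P_def exponent_le_def)
  ultimately show ?thesis by (meson le_trans not_less)
qed

lemma iterated_sumset_lower_bound:
  assumes "\<And>u. u \<in> B \<Longrightarrow> m \<le> (\<Sum>i\<in>A. Poly_Mapping.lookup u i)" "h \<in> iterated_sumset k B"
  shows "k * m \<le> (\<Sum>i\<in>A. Poly_Mapping.lookup h i)"
  using assms(2)
proof (induction k arbitrary: h)
  case (Suc k)
  then obtain a b where "a \<in> B" "b \<in> iterated_sumset k B" "h = a + b"
    by (auto simp: sumset_def)
  with Suc.IH[of b] assms(1)[of a] show ?case
    by (simp add: lookup_add sum.distrib)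
qed simp

lemma multiple_in_iterated_sumset:
  assumes "u \<in> B"
  shows "\<exists>h\<in>iterated_sumset k B. \<forall>i. Poly_Mapping.lookup h i = k * Poly_Mapping.lookup u i"
proof (induction k)
  case (Suc k)
  then obtain h where "h \<in> iterated_sumset k B" "\<forall>i. Poly_Mapping.lookup h i = k * Poly_Mapping.lookup u i" ..
  with assms show ?case
    by (intro bexI[of _ "u + h"]) (auto simp: sumset_def lookup_add)
qed simp

text \<open>The inclusion of \<open>I^(k+1) : I\<close> in \<open>I^k\<close> for exponents.
  Otherwise some \<open>A\<close> separates \<open>c\<close>. Take \<open>b\<close> of minimal
  degree \<open>s b\<close> in \<open>A\<close>: the \<open>k\<close>-fold multiple of
  \<open>b\<close> shows \<open>s c < k * s b\<close>, while every divisor of \<open>c + b\<close>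
  in the next sumset has degree at least \<open>Suc k * s b\<close> in \<open>A\<close>.\<close>

lemma strong_persistence:
  fixes B :: "'n::finite expo set"
  assumes B: "exchange B" "B \<noteq> {}" and deg: "\<forall>u\<in>B. exponent_degree u = d"
    and c: "\<And>b. b \<in> B \<Longrightarrow> \<exists>h\<in>iterated_sumset (Suc k) B. exponent_le h (c + b)"
  shows "\<exists>u\<in>iterated_sumset k B. exponent_le u c"
proof (rule ccontr)
  assume "\<not> ?thesis"
  with separating_coordinates[of "iterated_sumset k B" "k * d" c] B(1) deg obtain A
    where A: "\<And>h. h \<in> iterated_sumset k B \<Longrightarrow>
      (\<Sum>i\<in>A. Poly_Mapping.lookup c i) < (\<Sum>i\<in>A. Poly_Mapping.lookup h i)"
    using exchange_iterated_sumset degree_iterated_sumset by blast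
  define s where "s u = (\<Sum>i\<in>A. Poly_Mapping.lookup u i)" for u :: "'n expo"
  obtain b where b: "b \<in> B" and min: "\<And>u. u \<in> B \<Longrightarrow> s b \<le> s u"
    using B(2) ex_has_least_nat[of "\<lambda>u. u \<in> B" _ s] by blast
  obtain h where h: "h \<in> iterated_sumset k B" "\<And>i. Poly_Mapping.lookup h i = k * Poly_Mapping.lookup b i"
    using multiple_in_iterated_sumset[OF b] by blast
  have "s c < k * s b"
    using A[OF h(1)] by (simp add: s_def h(2) sum_distrib_left)
  moreover obtain g where g: "g \<in> iterated_sumset (Suc k) B" "exponent_le g (c + b)"
    using c[OF b] by blast
  have "s g \<le> s (c + b)"
    using g(2) by (auto simp: s_def exponent_le_def intro: sum_mono)
  moreover have "s (c + b) = s c + s b" by (simp add: s_def lookup_add sum.distrib)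
  moreover have "Suc k * s b \<le> s g"
    using iterated_sumset_lower_bound[OF _ g(1), of "s b" A] min by (simp add: s_def)
  ultimately show False by simp
qed

section \<open>Monomials with at least two divisors\<close>

definition two_divisors :: "'n expo set \<Rightarrow> 'n expo \<Rightarrow> bool"
  where "two_divisors B a \<longleftrightarrow> (\<exists>u\<in>B. \<exists>v\<in>B. u \<noteq> v \<and> exponent_le u a \<and> exponent_le v a)"

text \<open>
  If \<open>c\<close> had a unique divisor \<open>u = b + w\<close>, then \<open>u\<close> would be maximal in every coordinate in which
  it differs from \<open>c\<close>, hence so would \<open>b\<close>, and \<open>u + b\<close> would be the only divisor of \<open>c + b\<close>.
\<close>

lemma two_divisors_persistence:
  fixes B :: "'n::finite expo set"
  assumes B: "exchange B" "B \<noteq> {}" and deg: "\<forall>u\<in>B. exponent_degree u = d"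
    and c: "\<And>b. b \<in> B \<Longrightarrow> two_divisors (iterated_sumset (Suc (Suc k)) B) (c + b)"
  shows "two_divisors (iterated_sumset (Suc k) B) c"
proof (rule ccontr)
  assume not: "\<not> ?thesis"
  define C where "C = iterated_sumset (Suc k) B"
  have C: "exchange C" "\<forall>u\<in>C. exponent_degree u = Suc k * d"
    using exchange_iterated_sumset[OF B(1)] degree_iterated_sumset[OF deg] unfolding C_def by blast+
  have C2: "iterated_sumset (Suc (Suc k)) B = sumset B C" by (simp add: C_def)
  have "\<exists>u\<in>C. exponent_le u c"
    unfolding C_def
  proof (rule strong_persistence[OF B deg])
    fix b assume "b \<in> B"
    from c[OF this] show "\<exists>h\<in>iterated_sumset (Suc (Suc k)) B. exponent_le h (c + b)"
      unfolding two_divisors_def by blast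
  qed
  then obtain u where u: "u \<in> C" "exponent_le u c" by blast
  \<comment> \<open>Here it matters that the sumset is at least 1-fold: a summand \<open>b\<close>
    of \<open>u\<close> is split off, and the hypothesis will be tested on this
    \<open>b\<close>.\<close>
  from u(1) obtain b w where b: "b \<in> B" "w \<in> iterated_sumset k B" "u = b + w"
    by (auto simp: C_def sumset_def)
  \<comment> \<open>If some \<open>v\<close> were larger at \<open>l\<close>, dual exchange would
    raise \<open>u\<close> at \<open>l\<close>; since \<open>c\<close> has room there, the result
    would be a second divisor of \<open>c\<close>.\<close>
  have max: "Poly_Mapping.lookup v l \<le> Poly_Mapping.lookup u l"
    if v: "v \<in> C" and l: "Poly_Mapping.lookup u l < Poly_Mapping.lookup c l" for v l
  proof (rule ccontr)
    assume "\<not> ?thesis"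
    then obtain i w where w: "i \<noteq> l" "w \<in> C" "w + unit_expo i = u + unit_expo l"
      using exchange_dual[OF C u(1) v, of l] unfolding not_le by blast
    have "w \<noteq> u"
    proof
      assume "w = u"
      with w(3) have "unit_expo i = unit_expo l" by simp
      from arg_cong[OF this, of "\<lambda>x. Poly_Mapping.lookup x i"] w(1) show False
        by (simp add: lookup_single when_def)
    qed
    moreover have "exponent_le w c"
      unfolding exponent_le_def
    proof
      fix k
      show "Poly_Mapping.lookup w k \<le> Poly_Mapping.lookup c k"
        using arg_cong[OF w(3), of "\<lambda>x. Poly_Mapping.lookup x k"] u(2)[unfolded exponent_le_def, rule_format, of k] l
        by (auto simp: lookup_add lookup_single when_def split: if_splits)
    qed
    ultimately show False using not u w(2) by (auto simp: two_divisors_def C_def)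
  qed
  have "v = b + u" if v': "v \<in> sumset B C" and le: "exponent_le v (c + b)" for v
  proof (rule exponent_le_antisym_degree)
    obtain b' w' where v: "b' \<in> B" "w' \<in> C" "v = b' + w'" using v' by (auto simp: sumset_def)
    show "exponent_le v (b + u)" unfolding exponent_le_def
    proof
      fix l
      show "Poly_Mapping.lookup v l \<le> Poly_Mapping.lookup (b + u) l"
      proof (cases "Poly_Mapping.lookup u l < Poly_Mapping.lookup c l")
        case True
        \<comment> \<open>Comparing \<open>b' + w\<close> with \<open>u = b + w\<close> bounds
          \<open>b'\<close> by \<open>b\<close> at \<open>l\<close>; comparing \<open>w'\<close>
          with \<open>u\<close> bounds the other summand.\<close>
        have "b' + w \<in> C" using v(1) b(2) by (auto simp: C_def sumset_def)
        from max[OF this True] max[OF v(2) True] show ?thesis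
          by (simp add: v(3) b(3) lookup_add)
      next
        case False
        then show ?thesis
          using le[unfolded exponent_le_def, rule_format, of l]
            u(2)[unfolded exponent_le_def, rule_format, of l]
          by (simp add: lookup_add)
      qed
    qed
    show "exponent_degree v = exponent_degree (b + u)"
      using v b(1) u(1) deg C(2) by simp
  qed
  with c[OF b(1)] show False unfolding C2 two_divisors_def by metis
qed

lemma two_divisors_add:
  assumes "two_divisors (iterated_sumset k B) c" "b \<in> B"
  shows "two_divisors (iterated_sumset (Suc k) B) (c + b)"
proof -
  obtain u v where "u \<in> iterated_sumset k B" "v \<in> iterated_sumset k B" "u \<noteq> v"
      "exponent_le u c" "exponent_le v c"
    using assms(1) by (auto simp: two_divisors_def)
  moreover have "b + u \<noteq> b + v" using \<open>u \<noteq> v\<close> by simp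
  ultimately show ?thesis unfolding two_divisors_def
    using assms(2) by (intro bexI[of _ "b + u"] bexI[of _ "b + v"])
      (auto simp: sumset_def exponent_le_def lookup_add add_mono add.commute)
qed

section \<open>Monomial ideals\<close>

lemma lookup_single_times:
  fixes f :: "('n, 'k::comm_ring_1) mpoly"
  shows "Poly_Mapping.lookup (Poly_Mapping.single a c * f) m =
    (if exponent_le a m then c * Poly_Mapping.lookup f (m - a) else 0)"
proof -
  have "Poly_Mapping.lookup (Poly_Mapping.single a c * f) m
      = (\<Sum>l. (c * (\<Sum>q. Poly_Mapping.lookup f q when m = l + q)) when l = a)"
    unfolding lookup_mult by (rule Sum_any.cong) (auto simp: lookup_single when_def)
  also have "\<dots> = c * (\<Sum>q. Poly_Mapping.lookup f q when m = a + q)"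
    by (rule Sum_any_when_equal)
  also have "\<dots> = (if exponent_le a m then c * Poly_Mapping.lookup f (m - a) else 0)"
  proof (cases "exponent_le a m")
    case True
    then obtain d where "m = a + d" by (auto simp: exponent_le_iff)
    then have "(\<Sum>q. Poly_Mapping.lookup f q when m = a + q) = (\<Sum>q. Poly_Mapping.lookup f q when q = m - a)"
      by (intro Sum_any.cong) (auto simp: when_def)
    also have "\<dots> = Poly_Mapping.lookup f (m - a)" by (rule Sum_any_when_equal)
    finally show ?thesis using True by simp
  next
    case False
    then have "m \<noteq> a + q" for q by (auto simp: exponent_le_iff)
    then show ?thesis using False by simp
  qed
  finally show ?thesis .
qed

lemma monom_times_cancel:
  fixes f :: "('n, 'k::comm_ring_1) mpoly"
  assumes "monom a * f = 0"
  shows "f = 0"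
proof (rule poly_mapping_eqI)
  fix m
  have "exponent_le a (a + m)" by (auto simp: exponent_le_iff)
  then have "Poly_Mapping.lookup f m = Poly_Mapping.lookup (monom a * f) (a + m)"
    by (simp add: lookup_single_times)
  then show "Poly_Mapping.lookup f m = Poly_Mapping.lookup 0 m" using assms by simp
qed

lemma sum_of_terms:
  "f = (\<Sum>m\<in>Poly_Mapping.keys f. Poly_Mapping.single m (Poly_Mapping.lookup f m))"
  by (rule poly_mapping_eqI)
    (auto simp: lookup_sum lookup_single when_def in_keys_iff)

lemma single_sum:
  "Poly_Mapping.single m (\<Sum>x\<in>X. f x) = (\<Sum>x\<in>X. Poly_Mapping.single m (f x))"
  by (rule poly_mapping_eqI) (simp add: lookup_sum lookup_single when_def)

text \<open>The polynomials satisfying the condition on terms form an ideal containing the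
  generators; conversely each term of such an \<open>f\<close> is a multiple of a generator.\<close>

lemma in_monomial_ideal_iff:
  fixes f :: "('n, 'k::comm_ring_1) mpoly"
  shows "f \<in> ideal_of (monom ` A) \<longleftrightarrow> (\<forall>m\<in>Poly_Mapping.keys f. \<exists>b\<in>A. exponent_le b m)"
proof
  define T :: "('n, 'k) mpoly set"
    where "T = {f. \<forall>m\<in>Poly_Mapping.keys f. \<exists>b\<in>A. exponent_le b m}"
  have "ideal_of (monom ` A) \<subseteq> T"
  proof (rule ideal.span_minimal)
    show "monom ` A \<subseteq> T" by (auto simp: T_def exponent_le_def)
    show "is_ideal T"
    proof (rule ideal.subspaceI)
      show "0 \<in> T" by (simp add: T_def)
      show "f + g \<in> T" if "f \<in> T" "g \<in> T" for f g
        using that keys_add[of f g] unfolding T_def by blast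
      show "c * f \<in> T" if "f \<in> T" for c f
      proof -
        have "\<exists>b\<in>A. exponent_le b m" if "m \<in> Poly_Mapping.keys (c * f)" for m
        proof -
          obtain p q where pq: "m = p + q" "q \<in> Poly_Mapping.keys f"
            using \<open>m \<in> Poly_Mapping.keys (c * f)\<close> keys_mult[of c f] by blast
          then obtain b where "b \<in> A" "exponent_le b q" using \<open>f \<in> T\<close> unfolding T_def by blast
          then show ?thesis
            by (intro bexI[of _ b]) (auto simp: pq exponent_le_def lookup_add trans_le_add2)
        qed
        then show ?thesis by (simp add: T_def)
      qed
    qed
  qed
  then show "f \<in> ideal_of (monom ` A) \<Longrightarrow> \<forall>m\<in>Poly_Mapping.keys f. \<exists>b\<in>A. exponent_le b m"
    unfolding T_def by blast
next
  assume f: "\<forall>m\<in>Poly_Mapping.keys f. \<exists>b\<in>A. exponent_le b m"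
  have "(\<Sum>m\<in>Poly_Mapping.keys f. Poly_Mapping.single m (Poly_Mapping.lookup f m))
      \<in> ideal_of (monom ` A)"
  proof (rule ideal.span_sum)
    fix m assume "m \<in> Poly_Mapping.keys f"
    then obtain b c where bc: "b \<in> A" "m = b + c" using f by (auto simp: exponent_le_iff)
    then have "Poly_Mapping.single c (Poly_Mapping.lookup f m) * monom b \<in> ideal_of (monom ` A)"
      by (intro ideal.span_scale ideal.span_base) auto
    then show "Poly_Mapping.single m (Poly_Mapping.lookup f m) \<in> ideal_of (monom ` A)"
      by (simp add: mult_single bc add.commute)
  qed
  then show "f \<in> ideal_of (monom ` A)" by (simp flip: sum_of_terms)
qed

lemma monom_dvd_if_exponent_le:
  fixes f :: "('n, 'k::comm_ring_1) mpoly"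
  assumes "\<And>m. m \<in> Poly_Mapping.keys f \<Longrightarrow> exponent_le g m"
  shows "\<exists>q. f = monom g * q"
proof -
  have "f \<in> ideal_of (monom ` {g})"
    using assms by (subst in_monomial_ideal_iff) auto
  then show ?thesis by (auto simp: ideal.span_singleton mult.commute)
qed

text \<open>By the degree bound, the only term of \<open>f\<close> that can divide \<open>u\<close>
  is \<open>u\<close> itself, which leaves the constant term of \<open>g\<close>.\<close>

lemma lookup_times_low_degree:
  fixes f g :: "('n::finite, 'k::comm_ring_1) mpoly"
  assumes "\<And>m. m \<in> Poly_Mapping.keys f \<Longrightarrow> exponent_degree u \<le> exponent_degree m"
  shows "Poly_Mapping.lookup (f * g) u = Poly_Mapping.lookup f u * Poly_Mapping.lookup g 0"
proof -
  have "Poly_Mapping.lookup (f * g) u =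
      Poly_Mapping.lookup ((\<Sum>m\<in>Poly_Mapping.keys f. Poly_Mapping.single m (Poly_Mapping.lookup f m)) * g) u"
    by (simp flip: sum_of_terms)
  also have "\<dots> = (\<Sum>m\<in>Poly_Mapping.keys f. if exponent_le m u
      then Poly_Mapping.lookup f m * Poly_Mapping.lookup g (u - m) else 0)"
    by (simp add: sum_distrib_right lookup_sum lookup_single_times)
  also have "\<dots> = (\<Sum>m\<in>Poly_Mapping.keys f. if m = u
      then Poly_Mapping.lookup f u * Poly_Mapping.lookup g 0 else 0)"
  proof (rule sum.cong[OF refl])
    fix m assume "m \<in> Poly_Mapping.keys f"
    then have "exponent_le m u \<longleftrightarrow> m = u"
      using assms[of m] exponent_degree_mono[of m u] exponent_le_antisym_degree[of m u]
      by (auto simp: exponent_le_def)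
    then show "(if exponent_le m u then Poly_Mapping.lookup f m * Poly_Mapping.lookup g (u - m) else 0)
        = (if m = u then Poly_Mapping.lookup f u * Poly_Mapping.lookup g 0 else 0)"
      by simp
  qed
  also have "\<dots> = Poly_Mapping.lookup f u * Poly_Mapping.lookup g 0"
    by (auto simp: in_keys_iff)
  finally show ?thesis .
qed

lemma ideal_mult_monomial:
  "ideal_mult (ideal_of (monom ` A)) (ideal_of (monom ` B)) =
    (ideal_of (monom ` sumset A B) :: ('n, 'k::comm_ring_1) mpoly set)"
proof
  show "ideal_mult (ideal_of (monom ` A)) (ideal_of (monom ` B)) \<subseteq>
      (ideal_of (monom ` sumset A B) :: ('n, 'k) mpoly set)"
    unfolding ideal_mult_def
  proof (rule ideal.span_minimal[OF _ ideal.subspace_span], rule subsetI)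
    fix h :: "('n, 'k) mpoly"
    assume "h \<in> {a * b |a b. a \<in> ideal_of (monom ` A) \<and> b \<in> ideal_of (monom ` B)}"
    then obtain f g where h: "h = f * g" "f \<in> ideal_of (monom ` A)" "g \<in> ideal_of (monom ` B)"
      by blast
    show "h \<in> ideal_of (monom ` sumset A B)"
      unfolding in_monomial_ideal_iff
    proof
      fix m assume "m \<in> Poly_Mapping.keys h"
      then obtain p q where m: "m = p + q" "p \<in> Poly_Mapping.keys f" "q \<in> Poly_Mapping.keys g"
        using keys_mult[of f g] h(1) by blast
      then obtain a b where ab: "a \<in> A" "exponent_le a p" "b \<in> B" "exponent_le b q"
        using h(2,3) unfolding in_monomial_ideal_iff by blast
      then have "exponent_le (a + b) m"
        by (simp add: m(1) exponent_le_def lookup_add add_mono)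
      moreover have "a + b \<in> sumset A B" using ab by (auto simp: sumset_def)
      ultimately show "\<exists>c\<in>sumset A B. exponent_le c m" by blast
    qed
  qed
  show "(ideal_of (monom ` sumset A B) :: ('n, 'k) mpoly set) \<subseteq>
      ideal_mult (ideal_of (monom ` A)) (ideal_of (monom ` B))"
    unfolding ideal_mult_def
  proof (rule ideal.span_mono, rule subsetI)
    fix h :: "('n, 'k) mpoly"
    assume "h \<in> monom ` sumset A B"
    then obtain a b where "a \<in> A" "b \<in> B" "h = monom a * monom b"
      by (auto simp: sumset_def mult_single)
    then show "h \<in> {a * b |a b. a \<in> ideal_of (monom ` A) \<and> b \<in> ideal_of (monom ` B)}"
      using ideal.span_base[of "monom a" "monom ` A"] ideal.span_base[of "monom b" "monom ` B"]
      by blast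
  qed
qed

lemma ideal_power_monomial:
  "ideal_power (ideal_of (monom ` B)) k =
    (ideal_of (monom ` iterated_sumset k B) :: ('n, 'k::comm_ring_1) mpoly set)"
proof (induction k)
  case 0
  have "f \<in> ideal_of (monom ` {0})" for f :: "('n, 'k) mpoly"
    unfolding in_monomial_ideal_iff by (auto simp: exponent_le_def)
  then show ?case by auto
next
  case (Suc k)
  then show ?case by (simp add: ideal_mult_monomial)
qed

section \<open>First Tor modules of monomial ideals\<close>

lemma boundary_map_scale:
  "boundary_map P i (\<lambda>b. p * v b) = (\<lambda>c. p * boundary_map P i v c)"
  by (rule ext) (simp add: boundary_map_def sum_distrib_left)

lemma boundary_map_diff:
  "boundary_map P i (\<lambda>b. v b - w b) = (\<lambda>c. boundary_map P i v c - boundary_map P i w c)"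
  unfolding boundary_map_def left_diff_distrib sum_subtractf by (rule ext) simp

lemma graded_free_resolutionD:
  assumes "graded_free_resolution P"
  shows "\<And>i b c m. \<lbrakk>b < rank P (Suc i); c < rank P i; m \<in> Poly_Mapping.keys (diff P i b c)\<rbrakk>
      \<Longrightarrow> m + shift P i c = shift P (Suc i) b"
    and "\<And>b. \<lbrakk>b < rank P 0; aug P b \<noteq> 0\<rbrakk> \<Longrightarrow> shift P 0 b = 0"
    and "aug_map P ` chains P UNIV 0 = UNIV"
    and "boundaries P UNIV 0 = {v \<in> chains P UNIV 0. aug_map P v = 0}"
    and "cycles P UNIV (Suc i) = boundaries P UNIV (Suc i)"
proof -
  note P = assms[unfolded graded_free_resolution_def]
  show "\<And>i b c m. \<lbrakk>b < rank P (Suc i); c < rank P i; m \<in> Poly_Mapping.keys (diff P i b c)\<rbrakk>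
      \<Longrightarrow> m + shift P i c = shift P (Suc i) b"
    using P[THEN conjunct1] by blast
  show "\<And>b. \<lbrakk>b < rank P 0; aug P b \<noteq> 0\<rbrakk> \<Longrightarrow> shift P 0 b = 0"
    using P[THEN conjunct2, THEN conjunct1] by blast
  show "aug_map P ` chains P UNIV 0 = UNIV"
    by (rule P[THEN conjunct2, THEN conjunct2, THEN conjunct1])
  show "boundaries P UNIV 0 = {v \<in> chains P UNIV 0. aug_map P v = 0}"
    by (rule P[THEN conjunct2, THEN conjunct2, THEN conjunct2, THEN conjunct1, symmetric])
  show "cycles P UNIV (Suc i) = boundaries P UNIV (Suc i)"
    by (rule P[THEN conjunct2, THEN conjunct2, THEN conjunct2, THEN conjunct2, THEN spec])
qed

section \<open>Vanishing of the first Tor in degrees without two divisors\<close>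

text \<open>
  If \<open>g\<close> is the only generator dividing the monomial of degree \<open>a\<close>, then a cycle of degree \<open>a\<close> is
  \<open>monom g\<close> times a cycle of the resolution itself.
\<close>

lemma Tor1_two_divisors:
  fixes B :: "'n expo set"
  assumes "Tor_nonzero 1 (ideal_of (monom ` B) :: ('n, 'k::field) mpoly set) a"
  shows "two_divisors B a"
proof (rule ccontr)
  assume unique: "\<not> two_divisors B a"
  let ?J = "ideal_of (monom ` B) :: ('n, 'k) mpoly set"
  \<comment> \<open>The resolution is whichever one witnesses \<open>Tor_nonzero\<close>, so only
    exactness and the grading are available.\<close>
  from assms obtain P :: "('n, 'k) free_complex" and z where P: "graded_free_resolution P"
    and z: "z \<in> cycles P ?J (Suc 0)" "homogeneous_chain P (Suc 0) a z" "z \<notin> boundaries P ?J (Suc 0)"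
    by (auto simp: Tor_nonzero_def One_nat_def)
  have zJ: "z b \<in> ?J" and z_out: "b \<ge> rank P (Suc 0) \<Longrightarrow> z b = 0" for b
    using z(1) by (cases "b < rank P (Suc 0)"; auto simp: chains_def ideal.span_zero)+
  have div: "\<exists>g\<in>B. exponent_le g m \<and> exponent_le g a" if m: "m \<in> Poly_Mapping.keys (z b)" for b m
  proof -
    have b: "b < rank P (Suc 0)" using m z_out[of b] by (cases "b < rank P (Suc 0)") auto
    then have "a = m + shift P (Suc 0) b"
      using z(2) m by (auto simp: homogeneous_chain_def)
    moreover obtain g where "g \<in> B" "exponent_le g m"
      using zJ[of b] m unfolding in_monomial_ideal_iff by blast
    ultimately show ?thesis
      by (intro bexI[of _ g]) (auto simp: exponent_le_def lookup_add trans_le_add1)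
  qed
  have "\<exists>b m. m \<in> Poly_Mapping.keys (z b)"
  proof (rule ccontr)
    assume "\<not> ?thesis"
    then have "z b = 0" for b by (simp flip: keys_eq_empty)
    then have "z = boundary_map P (Suc 0) (\<lambda>_. 0)" by (auto simp: boundary_map_def)
    moreover have "(\<lambda>_. 0) \<in> chains P ?J (Suc (Suc 0))"
      by (simp add: chains_def ideal.span_zero)
    ultimately show False using z(3) by (auto simp: boundaries_def)
  qed
  then obtain g where g: "g \<in> B" "exponent_le g a" using div by blast
  have g_le: "exponent_le g m" if "m \<in> Poly_Mapping.keys (z b)" for b m
    using div[OF that] g unique unfolding two_divisors_def by metis
  have "\<exists>q. z b = monom g * q" for b
    using g_le by (rule monom_dvd_if_exponent_le)
  then obtain y where y: "z b = monom g * y b" for b by metis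
  then have z_eq: "z = (\<lambda>b. monom g * y b)" by blast
  have y_out: "y b = 0" if "b \<ge> rank P (Suc 0)" for b
    using monom_times_cancel[of g "y b"] y[of b] z_out[OF that] by simp
  have "boundary_map P 0 y c = 0" for c
  proof (rule monom_times_cancel)
    have "boundary_map P 0 z = (\<lambda>_. 0)" using z(1) by simp
    then show "monom g * boundary_map P 0 y c = 0"
      by (simp add: z_eq boundary_map_scale fun_eq_iff)
  qed
  \<comment> \<open>Exactness over the whole ring makes \<open>y\<close> a boundary; multiplying a
    preimage by \<open>monom g\<close> moves it into the ideal, so \<open>z\<close> is a boundary
    there.\<close>
  then have "y \<in> cycles P UNIV (Suc 0)" using y_out by (auto simp: chains_def)
  then have "y \<in> boundaries P UNIV (Suc 0)" unfolding graded_free_resolutionD(5)[OF P] .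
  then obtain w where w: "w \<in> chains P UNIV (Suc (Suc 0))" "y = boundary_map P (Suc 0) w"
    by (auto simp: boundaries_def)
  have gJ: "monom g * p \<in> ?J" for p
    unfolding mult.commute[of "monom g"] using g(1) by (intro ideal.span_scale ideal.span_base) blast
  have "(\<lambda>b. monom g * w b) \<in> chains P ?J (Suc (Suc 0))"
    using w(1) gJ by (simp add: chains_def)
  then have "boundary_map P (Suc 0) (\<lambda>b. monom g * w b) \<in> boundaries P ?J (Suc 0)"
    unfolding boundaries_def by (rule imageI)
  moreover have "boundary_map P (Suc 0) (\<lambda>b. monom g * w b) = z"
    by (simp add: z_eq boundary_map_scale w(2))
  ultimately show False using z(3) by metis
qed

section \<open>Homogeneous components in a resolution\<close>

definition homogeneous_part ::
    "('n, 'k::comm_ring_1) free_complex \<Rightarrow> nat \<Rightarrow> 'n expo \<Rightarrow> (nat \<Rightarrow> ('n, 'k) mpoly) \<Rightarrow> nat \<Rightarrow> ('n, 'k) mpoly"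
  where "homogeneous_part P i a v = (\<lambda>b. if b < rank P i \<and> exponent_le (shift P i b) a
    then Poly_Mapping.single (a - shift P i b) (Poly_Mapping.lookup (v b) (a - shift P i b)) else 0)"

lemma homogeneous_part_chains: "homogeneous_part P i a v \<in> chains P UNIV i"
  by (simp add: chains_def homogeneous_part_def)

lemma homogeneous_part_keys:
  assumes "m \<in> Poly_Mapping.keys (homogeneous_part P i a v b)"
  shows "m + shift P i b = a"
proof -
  from assms have "exponent_le (shift P i b) a" "m = a - shift P i b"
    by (auto simp: homogeneous_part_def split: if_splits)
  then show ?thesis
    by (intro poly_mapping_eqI) (simp add: exponent_le_def lookup_add lookup_minus)
qed

text \<open>The multigrading has only one monomial in each degree, so a homogeneous entry of the
  differential has at most one term.\<close>

lemma diff_eq_single: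
  assumes "graded_free_resolution P" "b < rank P (Suc i)" "c < rank P i"
  shows "diff P i b c = 0 \<or> (\<exists>e k. e + shift P i c = shift P (Suc i) b \<and> diff P i b c = Poly_Mapping.single e k)"
proof (cases "diff P i b c = 0")
  case False
  have deg: "m + shift P i c = shift P (Suc i) b" if "m \<in> Poly_Mapping.keys (diff P i b c)" for m
    using graded_free_resolutionD(1)[OF assms that] .
  from False obtain e where e: "e \<in> Poly_Mapping.keys (diff P i b c)"
    by (auto simp flip: keys_eq_empty)
  have "diff P i b c = Poly_Mapping.single e (Poly_Mapping.lookup (diff P i b c) e)"
  proof (rule poly_mapping_eqI)
    fix m
    show "Poly_Mapping.lookup (diff P i b c) m
        = Poly_Mapping.lookup (Poly_Mapping.single e (Poly_Mapping.lookup (diff P i b c) e)) m"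
    proof (cases "m \<in> Poly_Mapping.keys (diff P i b c)")
      case True
      then have "m + shift P i c = e + shift P i c" using deg[OF True] deg[OF e] by simp
      then show ?thesis by simp
    next
      case False
      then show ?thesis using e by (auto simp: lookup_single when_def in_keys_iff)
    qed
  qed
  then show ?thesis using deg[OF e] by blast
qed simp

text \<open>The differential has degree 0. This allows any preimage of a homogeneous chain to be
  replaced by a homogeneous one.\<close>

lemma boundary_map_homogeneous_part:
  assumes P: "graded_free_resolution P"
  shows "boundary_map P i (homogeneous_part P (Suc i) a v) = homogeneous_part P i a (boundary_map P i v)"
proof
  fix c
  show "boundary_map P i (homogeneous_part P (Suc i) a v) c = homogeneous_part P i a (boundary_map P i v) c"
  proof (cases "c < rank P i")
    case c: True
    let ?s = "shift P i c"
    have term_eq: "homogeneous_part P (Suc i) a v b * diff P i b c =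
        (if exponent_le ?s a then Poly_Mapping.single (a - ?s) (Poly_Mapping.lookup (v b * diff P i b c) (a - ?s)) else 0)"
      if b: "b < rank P (Suc i)" for b
    proof (cases "diff P i b c = 0")
      case False
      with diff_eq_single[OF P b c] obtain e k where e: "e + ?s = shift P (Suc i) b"
        and D: "diff P i b c = Poly_Mapping.single e k" by blast
      have D': "v b * diff P i b c = Poly_Mapping.single e k * v b"
        by (simp add: D mult.commute)
      show ?thesis
      proof (cases "exponent_le (shift P (Suc i) b) a")
        case True
        then obtain f where "a = e + ?s + f" using e by (auto simp: exponent_le_iff)
        then have f: "a = f + e + ?s" by (simp add: ac_simps)
        have "a - ?s = f + e"
          unfolding f by (rule add_diff_cancel_right')
        moreover have "a - shift P (Suc i) b = f" "f + e - e = f"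
          unfolding e[symmetric] f by (simp_all add: add.assoc)
        moreover have "exponent_le e (f + e)" "exponent_le ?s a"
          unfolding f by (auto simp: exponent_le_def lookup_add)
        ultimately show ?thesis
          using b True unfolding D' lookup_single_times
          by (simp add: homogeneous_part_def D mult_single ac_simps)
      next
        case False
        have "\<not> exponent_le e (a - ?s)" if s: "exponent_le ?s a"
        proof
          assume "exponent_le e (a - ?s)"
          then obtain g where g: "a - ?s = e + g" unfolding exponent_le_iff by blast
          obtain f where f: "a = ?s + f" using s unfolding exponent_le_iff by blast
          with g have "a = ?s + (e + g)" by simp
          also have "\<dots> = shift P (Suc i) b + g" unfolding e[symmetric] by (simp only: ac_simps)
          finally show False using False unfolding exponent_le_iff by blast
        qed
        then show ?thesis
          using False b unfolding D' lookup_single_times by (simp add: homogeneous_part_def)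
      qed
    qed (simp add: homogeneous_part_def)
    have "boundary_map P i (homogeneous_part P (Suc i) a v) c =
      (\<Sum>b<rank P (Suc i). if exponent_le ?s a
        then Poly_Mapping.single (a - ?s) (Poly_Mapping.lookup (v b * diff P i b c) (a - ?s)) else 0)"
      using c term_eq by (simp add: boundary_map_def)
    also have "\<dots> = homogeneous_part P i a (boundary_map P i v) c"
      using c by (auto simp: homogeneous_part_def boundary_map_def lookup_sum single_sum)
    finally show ?thesis .
  qed (simp add: boundary_map_def homogeneous_part_def)
qed

text \<open>A variable times a basis element is killed by the augmentation, hence is a boundary; the
  component of degree \<open>unit_expo j\<close> of a preimage is the lift.\<close>

lemma resolution_lift_variable:
  fixes P :: "('n, 'k::field) free_complex"
  assumes P: "graded_free_resolution P" and b0: "b0 < rank P 0" "shift P 0 b0 = 0"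
  obtains q where "q \<in> chains P UNIV (Suc 0)"
    "boundary_map P 0 q = (\<lambda>b. if b = b0 then monom (unit_expo j) else 0)"
    "\<And>b m. m \<in> Poly_Mapping.keys (q b) \<Longrightarrow> m + shift P (Suc 0) b = unit_expo j"
proof -
  define e :: "nat \<Rightarrow> ('n, 'k) mpoly"
    where "e = (\<lambda>b. if b = b0 then monom (unit_expo j) else 0)"
  have "unit_expo j \<noteq> 0"
    by (metis lookup_single_eq lookup_zero zero_neq_one)
  then have "aug_map P e = 0"
    by (auto simp: aug_map_def e_def lookup_single when_def intro: sum.neutral)
  moreover have "e \<in> chains P UNIV 0" using b0 by (auto simp: chains_def e_def)
  ultimately have "e \<in> boundaries P UNIV 0"
    unfolding graded_free_resolutionD(4)[OF P] by simp
  then obtain q where q: "e = boundary_map P 0 q" unfolding boundaries_def by blast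
  have "homogeneous_part P 0 (unit_expo j) e = e"
    using b0 by (auto simp: homogeneous_part_def e_def exponent_le_def)
  then have "boundary_map P 0 (homogeneous_part P (Suc 0) (unit_expo j) q) = e"
    by (simp add: boundary_map_homogeneous_part[OF P] flip: q)
  then show ?thesis
    using that[of "homogeneous_part P (Suc 0) (unit_expo j) q"]
      homogeneous_part_chains homogeneous_part_keys unfolding e_def by blast
qed

section \<open>Nonzero classes from linear syzygies\<close>

text \<open>
  \<open>linear_part P b\<close> is the scalar \<open>t\<close> such that the composition of \<open>P\<^sub>1 \<rightarrow> P\<^sub>0\<close> with the lift
  \<open>P\<^sub>0 \<rightarrow> S\<close> of the augmentation sends the basis element \<open>b\<close> to \<open>t\<close> times the monomial of its degree.
\<close>

definition linear_part :: "('n, 'k::field) free_complex \<Rightarrow> nat \<Rightarrow> 'k"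
  where "linear_part P b =
    (\<Sum>c<rank P 0. Poly_Mapping.lookup (diff P 0 b c) (shift P (Suc 0) b) * aug P c)"

text \<open>In degree 0 the linear part is the augmentation of the image of the basis element, and
  boundaries are killed by the augmentation.\<close>

lemma linear_part_shift_0:
  fixes P :: "('n, 'k::field) free_complex"
  assumes P: "graded_free_resolution P" and b: "b < rank P (Suc 0)" "shift P (Suc 0) b = 0"
  shows "linear_part P b = 0"
proof -
  define e :: "nat \<Rightarrow> ('n, 'k) mpoly" where "e = (\<lambda>c. if c = b then 1 else 0)"
  have "e \<in> chains P UNIV (Suc 0)" using b by (auto simp: chains_def e_def)
  then have "boundary_map P 0 e \<in> boundaries P UNIV 0" unfolding boundaries_def by blast
  then have "aug_map P (boundary_map P 0 e) = 0"
    unfolding graded_free_resolutionD(4)[OF P] by simp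
  moreover have "boundary_map P 0 e c = diff P 0 b c" if "c < rank P 0" for c
  proof -
    have "(\<Sum>b'<rank P (Suc 0). e b' * diff P 0 b' c)
        = (\<Sum>b'<rank P (Suc 0). if b' = b then diff P 0 b c else 0)"
      by (rule sum.cong) (auto simp: e_def)
    then show ?thesis using that b by (simp add: boundary_map_def)
  qed
  ultimately show ?thesis by (simp add: aug_map_def linear_part_def b)
qed

text \<open>Both sides are the coefficient of the variable \<open>j\<close> in the image of
  \<open>v\<close> under the composite map to the ring. A basis element can contribute only if its
  degree divides \<open>unit_expo j\<close>, and those of degree 0 have linear part 0.\<close>

lemma linear_part_boundary:
  fixes P :: "('n, 'k::field) free_complex"
  assumes P: "graded_free_resolution P"
  shows "(\<Sum>b | b < rank P (Suc 0) \<and> shift P (Suc 0) b = unit_expo j. Poly_Mapping.lookup (v b) 0 * linear_part P b)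
    = (\<Sum>c<rank P 0. Poly_Mapping.lookup (boundary_map P 0 v c) (unit_expo j) * aug P c)"
proof -
  let ?e = "unit_expo j" and ?s = "shift P (Suc 0)"
  have aug0: "shift P 0 c = 0" if "c < rank P 0" "aug P c \<noteq> 0" for c
    using graded_free_resolutionD(2)[OF P that] .
  have "(\<Sum>c<rank P 0. Poly_Mapping.lookup (boundary_map P 0 v c) ?e * aug P c)
      = (\<Sum>c<rank P 0. \<Sum>b<rank P (Suc 0). Poly_Mapping.lookup (v b * diff P 0 b c) ?e * aug P c)"
    by (simp add: boundary_map_def lookup_sum sum_distrib_right)
  also have "\<dots> = (\<Sum>b<rank P (Suc 0). \<Sum>c<rank P 0. Poly_Mapping.lookup (v b * diff P 0 b c) ?e * aug P c)"
    by (rule sum.swap)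
  also have "\<dots> = (\<Sum>b<rank P (Suc 0). if ?s b = ?e then Poly_Mapping.lookup (v b) 0 * linear_part P b else 0)"
  proof (rule sum.cong[OF refl])
    fix b assume "b \<in> {..<rank P (Suc 0)}"
    then have b: "b < rank P (Suc 0)" by simp
    have "(\<Sum>c<rank P 0. Poly_Mapping.lookup (v b * diff P 0 b c) ?e * aug P c)
      = (\<Sum>c<rank P 0. if exponent_le (?s b) ?e then Poly_Mapping.lookup (v b) (?e - ?s b) *
          (Poly_Mapping.lookup (diff P 0 b c) (?s b) * aug P c) else 0)"
    proof (rule sum.cong[OF refl])
      fix c assume "c \<in> {..<rank P 0}"
      then have c: "c < rank P 0" by simp
      show "Poly_Mapping.lookup (v b * diff P 0 b c) ?e * aug P c =
        (if exponent_le (?s b) ?e then Poly_Mapping.lookup (v b) (?e - ?s b) *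
          (Poly_Mapping.lookup (diff P 0 b c) (?s b) * aug P c) else 0)"
      proof (cases "aug P c = 0 \<or> diff P 0 b c = 0")
        case False
        with diff_eq_single[OF P b c] aug0[OF c] obtain k
          where D: "diff P 0 b c = Poly_Mapping.single (?s b) k" by auto
        show ?thesis
          unfolding D mult.commute[of "v b"] lookup_single_times by simp
      qed auto
    qed
    also have "\<dots> = (if exponent_le (?s b) ?e then Poly_Mapping.lookup (v b) (?e - ?s b) * linear_part P b else 0)"
      by (simp add: linear_part_def sum_distrib_left)
    also have "\<dots> = (if ?s b = ?e then Poly_Mapping.lookup (v b) 0 * linear_part P b else 0)"
    proof (cases "?s b = 0 \<or> ?s b = ?e")
      case True
      then show ?thesis using linear_part_shift_0[OF P b] by (auto simp: exponent_le_def)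
    next
      case False
      have "\<not> exponent_le (?s b) ?e"
      proof
        assume "exponent_le (?s b) ?e"
        then have le: "Poly_Mapping.lookup (?s b) i \<le> (if i = j then 1 else 0)" for i
          unfolding exponent_le_def lookup_single when_def by (auto simp: eq_commute[of j])
        show False
        proof (cases "Poly_Mapping.lookup (?s b) j = 0")
          case True
          have "?s b = 0"
          proof (rule poly_mapping_eqI)
            fix i show "Poly_Mapping.lookup (?s b) i = Poly_Mapping.lookup 0 i"
              using le[of i] True by (cases "i = j") auto
          qed
          with \<open>\<not> (?s b = 0 \<or> ?s b = ?e)\<close> show False by simp
        next
          case nz: False
          have "?s b = ?e"
          proof (rule poly_mapping_eqI)
            fix i show "Poly_Mapping.lookup (?s b) i = Poly_Mapping.lookup ?e i"
              using le[of i] nz by (cases "i = j") (auto simp: lookup_single when_def)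
          qed
          with \<open>\<not> (?s b = 0 \<or> ?s b = ?e)\<close> show False by simp
        qed
      qed
      then show ?thesis using False by simp
    qed
    finally show "(\<Sum>c<rank P 0. Poly_Mapping.lookup (v b * diff P 0 b c) ?e * aug P c)
      = (if ?s b = ?e then Poly_Mapping.lookup (v b) 0 * linear_part P b else 0)" .
  qed
  also have "\<dots> = (\<Sum>b | b < rank P (Suc 0) \<and> ?s b = ?e. Poly_Mapping.lookup (v b) 0 * linear_part P b)"
    by (simp add: sum.inter_filter[symmetric])
  finally show ?thesis ..
qed

text \<open>
  The cycle is \<open>x\<^sup>u q\<^sub>j - x\<^sup>v q\<^sub>i\<close> where \<open>q\<^sub>l\<close> lifts the variable \<open>x\<^sub>l\<close>. The functional
  \<open>\<Lambda>\<close> vanishes on boundaries because the elements of the ideal have degree at least that of \<open>u\<close>.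
\<close>

lemma Tor1_linear_syzygy:
  fixes B :: "'n::finite expo set"
  assumes deg: "\<forall>u\<in>B. exponent_degree u = d" and uv: "u \<in> B" "v \<in> B" "u \<noteq> v"
    and a: "v + unit_expo i = u + unit_expo j"
  shows "Tor_nonzero 1 (ideal_of (monom ` B) :: ('n, 'k::field) mpoly set) (u + unit_expo j)"
proof -
  let ?J = "ideal_of (monom ` B) :: ('n, 'k) mpoly set"
  obtain P :: "('n, 'k) free_complex" where P: "graded_free_resolution P"
    using ex_graded_free_resolution by blast
  \<comment> \<open>Surjectivity of the augmentation provides a basis element with nonzero image;
    its degree is then 0.\<close>
  obtain b0 where b0: "b0 < rank P 0" "aug P b0 \<noteq> 0"
  proof (rule ccontr)
    assume "\<not> thesis"
    with that have "aug P b = 0" if "b < rank P 0" for b using that by blast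
    then have "aug_map P x = 0" for x by (simp add: aug_map_def)
    moreover have "1 \<in> aug_map P ` chains P UNIV 0"
      unfolding graded_free_resolutionD(3)[OF P] by simp
    ultimately show False by auto
  qed
  have s0: "shift P 0 b0 = 0" using graded_free_resolutionD(2)[OF P b0] .
  obtain q where q: "q \<in> chains P UNIV (Suc 0)"
    "boundary_map P 0 q = (\<lambda>b. if b = b0 then monom (unit_expo j) else 0)"
    "\<And>b m. m \<in> Poly_Mapping.keys (q b) \<Longrightarrow> m + shift P (Suc 0) b = unit_expo j"
    using resolution_lift_variable[OF P b0(1) s0] by metis
  obtain r where r: "r \<in> chains P UNIV (Suc 0)"
    "boundary_map P 0 r = (\<lambda>b. if b = b0 then monom (unit_expo i) else 0)"
    "\<And>b m. m \<in> Poly_Mapping.keys (r b) \<Longrightarrow> m + shift P (Suc 0) b = unit_expo i"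
    using resolution_lift_variable[OF P b0(1) s0] by metis
  define z where "z = (\<lambda>b. monom u * q b - monom v * r b)"
  have "monom g * p \<in> ?J" if "g \<in> B" for g p
    unfolding mult.commute[of "monom g"] using that by (intro ideal.span_scale ideal.span_base) blast
  then have "z \<in> chains P ?J (Suc 0)"
    using q(1) r(1) uv by (simp add: chains_def z_def ideal.span_diff)
  moreover have "boundary_map P 0 z = (\<lambda>_. 0)"
    unfolding z_def boundary_map_diff boundary_map_scale q(2) r(2)
    by (rule ext) (simp add: mult_single a)
  ultimately have "z \<in> cycles P ?J (Suc 0)" by simp
  moreover have "homogeneous_chain P (Suc 0) (u + unit_expo j) z"
    unfolding homogeneous_chain_def
  proof (intro allI impI ballI)
    fix b m assume "m \<in> Poly_Mapping.keys (z b)"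
    then consider "m \<in> Poly_Mapping.keys (monom u * q b)" | "m \<in> Poly_Mapping.keys (monom v * r b)"
      using keys_diff[of "monom u * q b" "monom v * r b"] unfolding z_def by blast
    then show "m + shift P (Suc 0) b = u + unit_expo j"
    proof cases
      case 1
      then obtain n where "m = u + n" "n \<in> Poly_Mapping.keys (q b)"
        using keys_mult[of "monom u" "q b"] by auto
      then show ?thesis using q(3)[of n b] by (simp add: add.assoc)
    next
      case 2
      then obtain n where "m = v + n" "n \<in> Poly_Mapping.keys (r b)"
        using keys_mult[of "monom v" "r b"] by auto
      then show ?thesis using r(3)[of n b] by (simp add: add.assoc a)
    qed
  qed
  moreover have "z \<notin> boundaries P ?J (Suc 0)"
  proof
    assume "z \<in> boundaries P ?J (Suc 0)"
    then obtain w where w: "w \<in> chains P ?J (Suc (Suc 0))" "z = boundary_map P (Suc 0) w"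
      unfolding boundaries_def by blast
    define X where "X = {b. b < rank P (Suc 0) \<and> shift P (Suc 0) b = unit_expo j}"
    define \<Lambda> where "\<Lambda> x = (\<Sum>b\<in>X. Poly_Mapping.lookup (x b) u * linear_part P b)"
      for x :: "nat \<Rightarrow> ('n, 'k) mpoly"
    have \<tau>: "(\<Sum>b\<in>X. Poly_Mapping.lookup (x b) 0 * linear_part P b)
      = (\<Sum>c<rank P 0. Poly_Mapping.lookup (boundary_map P 0 x c) (unit_expo j) * aug P c)" for x
      unfolding X_def by (rule linear_part_boundary[OF P])
    \<comment> \<open>Hence the part \<open>monom v * r b\<close> contributes nothing at
      \<open>u\<close>, and \<open>\<Lambda> z\<close> is computed from the constant terms of
      \<open>q\<close> alone.\<close>
    have nle: "\<not> exponent_le v u"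
      using uv deg exponent_le_antisym_degree[of v u] by auto
    have "Poly_Mapping.lookup (z b) u = Poly_Mapping.lookup (q b) 0" for b
      using nle by (simp add: z_def lookup_minus lookup_single_times exponent_le_def[of u u])
    then have "\<Lambda> z = (\<Sum>c<rank P 0. Poly_Mapping.lookup (boundary_map P 0 q c) (unit_expo j) * aug P c)"
      unfolding \<tau>[symmetric] by (simp add: \<Lambda>_def)
    also have "\<dots> = (\<Sum>c<rank P 0. if c = b0 then aug P b0 else 0)"
      unfolding q(2) by (intro sum.cong) auto
    finally have "\<Lambda> z \<noteq> 0" using b0 by simp
    moreover have "\<Lambda> z = 0"
    proof -
      \<comment> \<open>The sum is the functional of \<open>linear_part_boundary\<close> on the
        image of a basis element under the next differential, so it vanishes because consecutive
        differentials compose to zero.\<close>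
      have row: "(\<Sum>b\<in>X. Poly_Mapping.lookup (diff P (Suc 0) b' b) 0 * linear_part P b) = 0"
        if b': "b' < rank P (Suc (Suc 0))" for b'
      proof -
        define e :: "nat \<Rightarrow> ('n, 'k) mpoly" where "e = (\<lambda>c. if c = b' then 1 else 0)"
        have "e \<in> chains P UNIV (Suc (Suc 0))" using b' by (auto simp: chains_def e_def)
        then have "boundary_map P (Suc 0) e \<in> boundaries P UNIV (Suc 0)" unfolding boundaries_def by blast
        then have cyc: "boundary_map P 0 (boundary_map P (Suc 0) e) = (\<lambda>_. 0)"
          unfolding graded_free_resolutionD(5)[OF P, symmetric] by simp
        have "boundary_map P (Suc 0) e c = diff P (Suc 0) b' c" if "c \<in> X" for c
        proof -
          have "(\<Sum>b<rank P (Suc (Suc 0)). e b * diff P (Suc 0) b c)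
              = (\<Sum>b<rank P (Suc (Suc 0)). if b = b' then diff P (Suc 0) b' c else 0)"
            by (rule sum.cong) (auto simp: e_def)
          then show ?thesis using that b' by (simp add: boundary_map_def X_def)
        qed
        then have "(\<Sum>b\<in>X. Poly_Mapping.lookup (diff P (Suc 0) b' b) 0 * linear_part P b)
          = (\<Sum>b\<in>X. Poly_Mapping.lookup (boundary_map P (Suc 0) e b) 0 * linear_part P b)"
          by (intro sum.cong) auto
        then show ?thesis by (simp add: \<tau> cyc)
      qed
      \<comment> \<open>Only the coefficient of \<open>w b'\<close> at \<open>u\<close> and the
        constant term of the differential can reach \<open>u\<close> in the product, so
        \<open>\<Lambda> z\<close> becomes a combination of the sums in \<open>row\<close>.\<close>
      have wdeg: "exponent_degree u \<le> exponent_degree m"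
        if b': "b' < rank P (Suc (Suc 0))" and m: "m \<in> Poly_Mapping.keys (w b')" for b' m
      proof -
        have "w b' \<in> ?J" using w(1) b' unfolding chains_def by blast
        then obtain g where "g \<in> B" "exponent_le g m" using m unfolding in_monomial_ideal_iff by blast
        then show ?thesis using deg uv(1) exponent_degree_mono[of g m] by simp
      qed
      have "\<Lambda> z = (\<Sum>b\<in>X. \<Sum>b'<rank P (Suc (Suc 0)).
          Poly_Mapping.lookup (w b' * diff P (Suc 0) b' b) u * linear_part P b)"
        unfolding \<Lambda>_def w(2)
        by (intro sum.cong) (auto simp: X_def boundary_map_def lookup_sum sum_distrib_right)
      also have "\<dots> = (\<Sum>b'<rank P (Suc (Suc 0)). \<Sum>b\<in>X.
          Poly_Mapping.lookup (w b' * diff P (Suc 0) b' b) u * linear_part P b)"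
        by (rule sum.swap)
      also have "\<dots> = (\<Sum>b'<rank P (Suc (Suc 0)). Poly_Mapping.lookup (w b') u *
          (\<Sum>b\<in>X. Poly_Mapping.lookup (diff P (Suc 0) b' b) 0 * linear_part P b))"
      proof (rule sum.cong[OF refl])
        fix b' assume "b' \<in> {..<rank P (Suc (Suc 0))}"
        then have "Poly_Mapping.lookup (w b' * g) u = Poly_Mapping.lookup (w b') u * Poly_Mapping.lookup g 0" for g
          by (intro lookup_times_low_degree wdeg) simp_all
        then show "(\<Sum>b\<in>X. Poly_Mapping.lookup (w b' * diff P (Suc 0) b' b) u * linear_part P b)
          = Poly_Mapping.lookup (w b') u *
            (\<Sum>b\<in>X. Poly_Mapping.lookup (diff P (Suc 0) b' b) 0 * linear_part P b)"
          by (simp add: sum_distrib_left)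
      qed
      also have "\<dots> = 0" by (simp add: row)
      finally show ?thesis .
    qed
    ultimately show False by simp
  qed
  ultimately show ?thesis
    unfolding Tor_nonzero_def One_nat_def using P by blast
qed

section \<open>The first homological shift ideal\<close>

lemma two_divisors_mono:
  assumes "two_divisors B a" "exponent_le a b"
  shows "two_divisors B b"
  using assms unfolding two_divisors_def exponent_le_def by (meson le_trans)

text \<open>Nonzero degrees have two divisors, and this passes to multiples. Conversely, given
  divisors \<open>u\<close> and \<open>v\<close> of \<open>m\<close>, dual exchange at a coordinate
  \<open>l\<close> where \<open>v\<close> is larger yields a linear syzygy in degree
  \<open>u + unit_expo l\<close>, which still divides \<open>m\<close>.\<close>

lemma in_HS1_iff:
  fixes f :: "('n::finite, 'k::field) mpoly"
  assumes B: "exchange B" and deg: "\<forall>u\<in>B. exponent_degree u = d"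
  shows "f \<in> HS 1 (ideal_of (monom ` B)) \<longleftrightarrow> (\<forall>m\<in>Poly_Mapping.keys f. two_divisors B m)"
proof -
  let ?J = "ideal_of (monom ` B) :: ('n, 'k) mpoly set"
  have "(\<exists>a. Tor_nonzero 1 ?J a \<and> exponent_le a m) \<longleftrightarrow> two_divisors B m" for m
  proof
    assume "\<exists>a. Tor_nonzero 1 ?J a \<and> exponent_le a m"
    then show "two_divisors B m" using Tor1_two_divisors two_divisors_mono by blast
  next
    assume "two_divisors B m"
    then obtain u v where uv: "u \<in> B" "v \<in> B" "u \<noteq> v" "exponent_le u m" "exponent_le v m"
      unfolding two_divisors_def by blast
    then have "\<not> exponent_le v u"
      using deg exponent_le_antisym_degree[of v u] by auto
    then obtain l where l: "Poly_Mapping.lookup u l < Poly_Mapping.lookup v l"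
      unfolding exponent_le_def by (auto simp: not_le)
    from exchange_dual[OF B deg uv(1,2) l] obtain i w
      where w: "i \<noteq> l" "w \<in> B" "w + unit_expo i = u + unit_expo l" by blast
    have "u \<noteq> w"
    proof
      assume "u = w"
      with w(3) have "unit_expo i = unit_expo l" by simp
      from arg_cong[OF this, of "\<lambda>x. Poly_Mapping.lookup x i"] w(1) show False
        by (simp add: lookup_single when_def)
    qed
    then have "Tor_nonzero 1 ?J (u + unit_expo l)"
      using Tor1_linear_syzygy[OF deg uv(1) w(2) _ w(3)] by blast
    moreover have "exponent_le (u + unit_expo l) m"
      unfolding exponent_le_def
    proof
      fix k
      show "Poly_Mapping.lookup (u + unit_expo l) k \<le> Poly_Mapping.lookup m k"
        using uv(4,5)[unfolded exponent_le_def, rule_format, of k] l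
        by (auto simp: lookup_add lookup_single when_def)
    qed
    ultimately show "\<exists>a. Tor_nonzero 1 ?J a \<and> exponent_le a m" by blast
  qed
  moreover have "HS 1 ?J = ideal_of (monom ` {a. Tor_nonzero 1 ?J a})"
    unfolding HS_def by (rule arg_cong[of _ _ ideal_of]) blast
  ultimately show ?thesis
    using in_monomial_ideal_iff[of f "{a. Tor_nonzero 1 ?J a}"] by simp
qed

section \<open>Colon ideals and associated primes\<close>

text \<open>Gives finiteness of the generating set, over which the argument for associated primes
  takes a product.\<close>

lemma finite_exponent_degree: "finite {a :: 'n::finite expo. exponent_degree a = d}"
proof (rule finite_imageD)
  have "Poly_Mapping.lookup ` {a :: 'n expo. exponent_degree a = d}
      \<subseteq> {f. \<forall>x. (x \<in> UNIV \<longrightarrow> f x \<in> {..d}) \<and> (x \<notin> UNIV \<longrightarrow> f x = 0)}"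
    using lookup_le_exponent_degree by auto
  then show "finite (Poly_Mapping.lookup ` {a :: 'n expo. exponent_degree a = d})"
    by (rule finite_subset) (intro finite_set_of_finite_funs; simp)
  show "inj_on Poly_Mapping.lookup {a :: 'n expo. exponent_degree a = d}"
    by (simp add: inj_on_def poly_mapping_eqI)
qed

lemma polymatroidal_generators:
  fixes I :: "('n::finite, 'k::field) mpoly set"
  assumes I: "polymatroidal I"
  obtains B d where "I = ideal_of (monom ` B)" "exchange B" "B \<noteq> {}" "finite B"
    "\<forall>u\<in>B. exponent_degree u = d"
proof -
  let ?B = "min_gens I"
  have gen: "I = ideal_of (monom ` ?B)"
    using I min_gens_unique[of I ?B] unfolding polymatroidal_def by blast
  have "?B \<noteq> {}"
  proof
    assume "?B = {}"
    with gen have "I = {0}" by (simp add: ideal.span_empty)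
    with I show False by (simp add: polymatroidal_def)
  qed
  then obtain u0 where "u0 \<in> ?B" by blast
  with I have deg: "\<forall>u\<in>?B. exponent_degree u = exponent_degree u0"
    unfolding polymatroidal_def exponent_degree_def by blast
  then have "finite ?B"
    by (intro finite_subset[OF _ finite_exponent_degree[of "exponent_degree u0"]]) auto
  have "exchange ?B"
    unfolding exchange_def
  proof (intro ballI allI impI)
    fix u v i assume "u \<in> ?B" "v \<in> ?B" and i: "Poly_Mapping.lookup v i < Poly_Mapping.lookup u i"
    with I obtain j where j: "Poly_Mapping.lookup u j < Poly_Mapping.lookup v j"
        "(u - unit_expo i) + unit_expo j \<in> ?B"
      unfolding polymatroidal_def by blast
    \<comment> \<open>No truncation occurs, since \<open>u\<close> is positive at
      \<open>i\<close>.\<close>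
    have "u - unit_expo i + unit_expo j + unit_expo i = u + unit_expo j"
      using i by (intro poly_mapping_eqI) (auto simp: lookup_add lookup_minus lookup_single when_def)
    with j show "\<exists>j. Poly_Mapping.lookup u j < Poly_Mapping.lookup v j \<and>
        (\<exists>w\<in>?B. w + unit_expo i = u + unit_expo j)" by blast
  qed
  from that[OF gen this \<open>?B \<noteq> {}\<close> \<open>finite ?B\<close> deg] show ?thesis .
qed

text \<open>All ideals involved are tested term by term, so the two inclusions become
  \<open>two_divisors_persistence\<close> and \<open>two_divisors_add\<close>. The successors encode
  that the smaller power is at least 1.\<close>

lemma colon_HS1:
  fixes B :: "'n::finite expo set" and k :: nat
  assumes B: "exchange B" "B \<noteq> {}" and deg: "\<forall>u\<in>B. exponent_degree u = d"
  defines "I \<equiv> ideal_of (monom ` B) :: ('n, 'k::field) mpoly set"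
  shows "ideal_colon (HS 1 (ideal_power I (Suc (Suc k)))) I = HS 1 (ideal_power I (Suc k))"
proof -
  have HS: "f \<in> HS 1 (ideal_power I l) \<longleftrightarrow>
      (\<forall>m\<in>Poly_Mapping.keys f. two_divisors (iterated_sumset l B) m)" for f l
    unfolding I_def ideal_power_monomial
    using in_HS1_iff exchange_iterated_sumset[OF B(1)] degree_iterated_sumset[OF deg] by blast
  show ?thesis
  proof (intro equalityI subsetI)
    fix f assume f: "f \<in> ideal_colon (HS 1 (ideal_power I (Suc (Suc k)))) I"
    show "f \<in> HS 1 (ideal_power I (Suc k))"
      unfolding HS
    proof
      fix m assume m: "m \<in> Poly_Mapping.keys f"
      show "two_divisors (iterated_sumset (Suc k) B) m"
      proof (rule two_divisors_persistence[OF B deg])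
        fix b assume "b \<in> B"
        then have "monom b \<in> I" unfolding I_def by (intro ideal.span_base) blast
        then have "f * monom b \<in> HS 1 (ideal_power I (Suc (Suc k)))"
          using f unfolding ideal_colon_def by blast
        \<comment> \<open>Multiplication by a monomial shifts the terms of \<open>f\<close> without
          cancellation.\<close>
        moreover have "m + b \<in> Poly_Mapping.keys (f * monom b)"
          using m by (simp add: in_keys_iff mult.commute[of f] lookup_single_times exponent_le_def lookup_add)
        ultimately show "two_divisors (iterated_sumset (Suc (Suc k)) B) (m + b)"
          unfolding HS by blast
      qed
    qed
  next
    fix f assume f: "f \<in> HS 1 (ideal_power I (Suc k))"
    show "f \<in> ideal_colon (HS 1 (ideal_power I (Suc (Suc k)))) I"
      unfolding ideal_colon_def
    proof (intro CollectI ballI)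
      fix g assume g: "g \<in> I"
      show "f * g \<in> HS 1 (ideal_power I (Suc (Suc k)))"
        unfolding HS
      proof
        fix m assume "m \<in> Poly_Mapping.keys (f * g)"
        then obtain p q where m: "m = p + q" "p \<in> Poly_Mapping.keys f" "q \<in> Poly_Mapping.keys g"
          using keys_mult[of f g] by blast
        obtain b where b: "b \<in> B" "exponent_le b q"
          using g m(3) unfolding I_def in_monomial_ideal_iff by blast
        have "two_divisors (iterated_sumset (Suc k) B) p" using f m(2) unfolding HS by blast
        from two_divisors_add[OF this b(1)] show "two_divisors (iterated_sumset (Suc (Suc k)) B) m"
          by (rule two_divisors_mono) (use b(2) in \<open>simp add: m(1) exponent_le_def lookup_add\<close>)
      qed
    qed
  qed
qed

section \<open>Associated primes of colon ideals\<close>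

lemma prod_notin_prime_ideal:
  assumes "prime_ideal p" "finite X" "\<And>x. x \<in> X \<Longrightarrow> h x \<notin> p"
  shows "(\<Prod>x\<in>X. h x) \<notin> p"
  using assms(2,3)
proof (induction X rule: finite_induct)
  case empty
  show ?case
  proof
    assume "(\<Prod>x\<in>{}. h x) \<in> p"
    then have "c * 1 \<in> p" for c
      using assms(1) unfolding prime_ideal_def by (intro ideal.subspace_scale) simp_all
    then show False using assms(1) unfolding prime_ideal_def by auto
  qed
next
  case (insert x X)
  then show ?case using assms(1) unfolding prime_ideal_def by auto
qed

text \<open>
  If \<open>p = (L : f)\<close> then \<open>p\<close> is the intersection of the ideals \<open>(M : f g)\<close> over the generators
  \<open>g\<close> of \<open>J\<close>, and a prime ideal that is a finite intersection of ideals is one of them.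
\<close>

lemma Ass_colon_subset:
  fixes M :: "'a::comm_ring_1 set"
  assumes M: "is_ideal M" and G: "finite G"
  shows "Ass (ideal_colon M (ideal_of G)) \<subseteq> Ass M"
proof
  fix p assume "p \<in> Ass (ideal_colon M (ideal_of G))"
  then obtain f where p: "prime_ideal p" "p = {g. g * f \<in> ideal_colon M (ideal_of G)}"
    unfolding Ass_def by blast
  have in_p: "h \<in> p \<longleftrightarrow> (\<forall>g\<in>G. h * (f * g) \<in> M)" for h
  proof
    assume "h \<in> p"
    then show "\<forall>g\<in>G. h * (f * g) \<in> M"
      using p(2) by (auto simp: ideal_colon_def ideal.span_base)
  next
    assume h: "\<forall>g\<in>G. h * (f * g) \<in> M"
    have "is_ideal {g. h * (f * g) \<in> M}"
    proof (rule ideal.subspaceI)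
      show "c * g \<in> {g. h * (f * g) \<in> M}" if "g \<in> {g. h * (f * g) \<in> M}" for c g
        using ideal.subspace_scale[OF M, of "h * (f * g)" c] that by (simp add: ac_simps del: ideal.scale_scale)
    qed (use ideal.subspace_0[OF M] ideal.subspace_add[OF M] in \<open>auto simp: distrib_left\<close>)
    then have "ideal_of G \<subseteq> {g. h * (f * g) \<in> M}" using h by (intro ideal.span_minimal) auto
    then show "h \<in> p" using p(2) by (auto simp: ideal_colon_def)
  qed
  have "\<exists>g\<in>G. \<forall>h. h * (f * g) \<in> M \<longrightarrow> h \<in> p"
  proof (rule ccontr)
    assume "\<not> ?thesis"
    \<comment> \<open>For each generator choose a multiplier outside \<open>p\<close>. The product
      of all of them sends every \<open>f * g\<close> into \<open>M\<close>, so it lies in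
      \<open>p\<close>, contradicting primality.\<close>
    then obtain h where h: "\<And>g. g \<in> G \<Longrightarrow> h g * (f * g) \<in> M \<and> h g \<notin> p" by metis
    have "(\<Prod>g\<in>G. h g) \<in> p"
      unfolding in_p
    proof
      fix g assume g: "g \<in> G"
      have "(\<Prod>g\<in>G. h g) * (f * g) = (\<Prod>g\<in>G - {g}. h g) * (h g * (f * g))"
        by (simp add: prod.remove[OF G g] ac_simps del: ideal.scale_scale)
      then show "(\<Prod>g\<in>G. h g) * (f * g) \<in> M"
        using ideal.subspace_scale[OF M] h[OF g] by metis
    qed
    then show False using prod_notin_prime_ideal[OF p(1) G] h by blast
  qed
  then obtain g where "g \<in> G" "\<And>h. h * (f * g) \<in> M \<Longrightarrow> h \<in> p" by blast
  then have "p = {h. h * (f * g) \<in> M}" using in_p by blast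
  then show "p \<in> Ass M" using p(1) unfolding Ass_def by blast
qed

end

theorem corollary7p4:
  fixes I :: "('n::finite, 'k::field) mpoly set"
  assumes "polymatroidal I"
  shows "(\<forall>k\<ge>1. ideal_colon (HS 1 (ideal_power I (k + 1))) I = HS 1 (ideal_power I k)) \<and>
    (\<forall>k\<ge>1. Ass (HS 1 (ideal_power I k)) \<subseteq> Ass (HS 1 (ideal_power I (k + 1))))"
proof -
  obtain B d where I: "I = ideal_of (monom ` B)" and B: "exchange B" "B \<noteq> {}" "finite B"
      "\<forall>u\<in>B. exponent_degree u = d"
    using polymatroidal_generators[OF assms] by metis
  have colon: "ideal_colon (HS 1 (ideal_power I (k + 1))) I = HS 1 (ideal_power I k)"
    if "k \<ge> 1" for k
    using that colon_HS1[OF B(1,2,4), of "k - 1"] unfolding I by simp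
  have "Ass (HS 1 (ideal_power I k)) \<subseteq> Ass (HS 1 (ideal_power I (k + 1)))" if "k \<ge> 1" for k
  proof -
    have "is_ideal (HS 1 (ideal_power I (k + 1)))"
      unfolding HS_def by (rule ideal.subspace_span)
    \<comment> \<open>The ideal for \<open>k\<close> is the colon ideal of the one for
      \<open>k + 1\<close> by \<open>I\<close>, whose generating set is finite.\<close>
    from Ass_colon_subset[OF this, of "monom ` B"] show ?thesis
      using B(3) colon[OF that] unfolding I by simp
  qed
  with colon show ?thesis by blast
qed

end
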